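(* Let $(a_k)_{k\ge 1}$ be a sequence of positive integers with $a_k \ge a_{k+1}$ for all $k\ge 1$. Then there exist a finite CW-space $X$ and a continuous self-map $f: X \to X$ such that $\operatorname{cat}(f^k)=a_k$ for every $k\ge 1$, and $\operatorname{cat} X=\operatorname{cat} f=a_1$.
   Context: Let $f: X \to Y$ be a continuous map of finite CW-spaces. An $f$-categorical set is an open subset $A$ of $X$ such that the restriction $f|_A: A \to Y$ is null-homotopic (homotopic to a constant map). An $f$-categorical covering is a covering $\{A_i\}$ of $X$ such that every set $A_i$ is $f$-categorical. The Lusternik--Schnirelmann category $\operatorname{cat} f$ of $f$ is the minimal number $k$ such that there exists an $f$-categorical covering of $X$ with $k$ elements (this is the non-normalized convention, so a one-point space has category $1$). For a finite CW-space $X$, $\operatorname{cat} X=\operatorname{cat} 1_X$, where $1_X$ is the identity map of $X$. For a self-map $f: X\to X$, $f^k$ denotes the $k$-fold composition $f\circ\cdots\circ f$. *)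

theory Defs
  imports "HOL-Analysis.Analysis"
begin

(* The library's Euclidean_space n consists of the real sequences that vanish from index n on,
   so closed_disc 0 and open_disc 0 are one-point sets and boundary_sphere 0 is empty. *)

definition closed_disc :: "nat \<Rightarrow> (nat \<Rightarrow> real) set" where
  "closed_disc n = {x \<in> topspace (Euclidean_space n). (\<Sum>i<n. (x i)\<^sup>2) \<le> 1}"

definition open_disc :: "nat \<Rightarrow> (nat \<Rightarrow> real) set" where
  "open_disc n = {x \<in> topspace (Euclidean_space n). (\<Sum>i<n. (x i)\<^sup>2) < 1}"

definition boundary_sphere :: "nat \<Rightarrow> (nat \<Rightarrow> real) set" where
  "boundary_sphere n = {x \<in> topspace (Euclidean_space n). (\<Sum>i<n. (x i)\<^sup>2) = 1}"

(* Whitehead's definition: the open cells \<Phi> i ` open_disc (d i) partition X.  Closure finiteness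
   and the weak topology need no separate clause because there are only finitely many cells. *)
definition finite_CW_structure ::
  "'a topology \<Rightarrow> 'i set \<Rightarrow> ('i \<Rightarrow> nat) \<Rightarrow> ('i \<Rightarrow> (nat \<Rightarrow> real) \<Rightarrow> 'a) \<Rightarrow> bool" where
  "finite_CW_structure X I d \<Phi> \<longleftrightarrow>
     Hausdorff_space X \<and>
     finite I \<and>
     (\<Union>i\<in>I. \<Phi> i ` open_disc (d i)) = topspace X \<and>
     disjoint_family_on (\<lambda>i. \<Phi> i ` open_disc (d i)) I \<and>
     (\<forall>i\<in>I.
        continuous_map (subtopology (Euclidean_space (d i)) (closed_disc (d i))) X (\<Phi> i) \<and>
        homeomorphic_map (subtopology (Euclidean_space (d i)) (open_disc (d i)))
          (subtopology X (\<Phi> i ` open_disc (d i))) (\<Phi> i) \<and>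
        \<Phi> i ` boundary_sphere (d i) \<subseteq> (\<Union>j\<in>{j \<in> I. d j < d i}. \<Phi> j ` open_disc (d j)))"

definition finite_CW_space :: "'a topology \<Rightarrow> bool" where
  "finite_CW_space X \<longleftrightarrow> (\<exists>(I :: nat set) d \<Phi>. finite_CW_structure X I d \<Phi>)"

definition map_categorical :: "'a topology \<Rightarrow> 'b topology \<Rightarrow> ('a \<Rightarrow> 'b) \<Rightarrow> 'a set \<Rightarrow> bool" where
  "map_categorical X Y f A \<longleftrightarrow>
     openin X A \<and>
     (\<exists>c\<in>topspace Y. homotopic_with (\<lambda>_. True) (subtopology X A) Y f (\<lambda>_. c))"

definition map_categorical_covering ::
  "'a topology \<Rightarrow> 'b topology \<Rightarrow> ('a \<Rightarrow> 'b) \<Rightarrow> 'a set set \<Rightarrow> bool" where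
  "map_categorical_covering X Y f \<A> \<longleftrightarrow>
     \<Union>\<A> = topspace X \<and> (\<forall>A\<in>\<A>. map_categorical X Y f A)"

(* Valued in enat, so that a map without a finite categorical covering has category \<infinity>;
   a nonempty infimum in enat is attained. *)
definition LS_cat_map :: "'a topology \<Rightarrow> 'b topology \<Rightarrow> ('a \<Rightarrow> 'b) \<Rightarrow> enat" where
  "LS_cat_map X Y f =
     Inf {enat (card \<A>) | \<A>. finite \<A> \<and> map_categorical_covering X Y f \<A>}"

definition LS_cat :: "'a topology \<Rightarrow> enat" where
  "LS_cat X = LS_cat_map X X id"

end

theory Submission
  imports Defs
begin

text \<open>
  The space is a wedge of tori \<open>T\<^sub>0 \<or> T\<^sub>1 \<or> \<dots> \<or> T\<^sub>M\<close> of dimensions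
  \<open>a\<^sub>1 - 1, a\<^sub>1 - 1, a\<^sub>2 - 1, \<dots>, a\<^sub>M - 1\<close>, where the sequence is constant from \<open>M\<close> on.
  The map projects each torus onto the next one and fixes the last, so the \<open>k\<close>-th iterate has
  image in the tori of index at least \<open>k\<close> (at most \<open>M\<close>) and maps \<open>T\<^sub>0\<close> onto one of dimension
  \<open>a\<^sub>k - 1\<close>.

  Upper bound: the open cells of dimension \<open>j\<close> thicken to disjoint open sets on which every circle
  coordinate has a continuous argument; scaling these arguments to zero contracts the union.

  Lower bound: suppose \<open>A\<^sub>1, \<dots>, A\<^sub>n\<close> is a categorical cover and the map is onto an \<open>n\<close>-torus.
  The \<open>i\<close>-th circle coordinate is null-homotopic on \<open>A\<^sub>i\<close>, hence has a real lift there; after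
  shrinking \<open>A\<^sub>i\<close> to a closed set the lift extends to a bounded function \<open>h\<^sub>i\<close> on the whole space.
  The equations \<open>\<theta>\<^sub>i = h\<^sub>i(\<theta>) + \<pi>\<close> have a common solution by the Poincare--Miranda theorem,
  but if that point lies in the shrunken \<open>A\<^sub>i\<close> then \<open>\<theta>\<^sub>i\<close> and \<open>h\<^sub>i(\<theta>)\<close> agree modulo \<open>2\<pi>\<close>.
\<close>

section \<open>The Poincare--Miranda theorem in variable dimension\<close>

text \<open>Kuhn's combinatorial lemma finds, for each mesh, a small grid cube on which every
  \<open>g i\<close> takes both signs; compactness then yields a common zero. Points are sequences,
  so that the dimension \<open>n\<close> can be a variable.\<close>

lemma poincare_miranda:
  fixes g :: "nat \<Rightarrow> (nat \<Rightarrow> real) \<Rightarrow> real"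
  assumes cont: "\<And>i. i < n \<Longrightarrow> continuous_on UNIV (g i)"
    and lo: "\<And>i u. \<lbrakk>i < n; u i = 0\<rbrakk> \<Longrightarrow> g i u \<le> 0"
    and hi: "\<And>i u. \<lbrakk>i < n; u i = 1\<rbrakk> \<Longrightarrow> 0 \<le> g i u"
  shows "\<exists>u. \<forall>i<n. g i u = 0"
proof -
  define pt where "pt p x = (\<lambda>j. if j < n then real (x j) / real p else 0)" for p and x :: "nat \<Rightarrow> nat"
  have "\<exists>Q P N. (\<forall>j. 0 \<le> Q j \<and> Q j \<le> 1) \<and>
          (\<forall>i<n. g i (P i) \<le> 0 \<and> 0 \<le> g i (N i) \<and>
             (\<forall>j. \<bar>P i j - Q j\<bar> \<le> 1 / real (Suc m) \<and> \<bar>N i j - Q j\<bar> \<le> 1 / real (Suc m)))" for m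
  proof -
    define p where "p = Suc m"
    \<comment> \<open>Kuhn's lemma prescribes the labels on opposite faces; \<open>lo\<close> and
      \<open>hi\<close> make these agree with the sign of \<open>g i\<close>, so a label always
      tells the sign.\<close>
    define label where "label x i = (if x i = 0 then 0 else if x i = p then 1
        else if g i (pt p x) \<le> 0 then 0 else (1::nat))" for x i
    obtain q where q: "\<forall>i<n. q i < p" and rs: "\<forall>i<n. \<exists>r s. (\<forall>j<n. q j \<le> r j \<and> r j \<le> q j + 1)
        \<and> (\<forall>j<n. q j \<le> s j \<and> s j \<le> q j + 1) \<and> label r i \<noteq> label s i"
      by (rule kuhn_lemma[of p n label]) (auto simp: label_def p_def)
    have near: "\<bar>pt p r j - pt p q j\<bar> \<le> 1 / real (Suc m)"
      if "\<forall>j<n. q j \<le> r j \<and> r j \<le> q j + 1" for r j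
    proof (cases "j < n")
      case True
      then have "\<bar>real (r j) - real (q j)\<bar> \<le> 1" using that by fastforce
      moreover have "pt p r j - pt p q j = (real (r j) - real (q j)) / real (Suc m)"
        using True by (simp add: pt_def p_def diff_divide_distrib)
      ultimately show ?thesis by (simp add: abs_divide divide_right_mono)
    qed (simp add: pt_def)
    have label0: "g i (pt p r) \<le> 0" if "label r i = 0" "i < n" for r i
      using that lo[of i "pt p r"] by (auto simp: label_def pt_def p_def split: if_splits)
    have label1: "0 \<le> g i (pt p r)" if "label r i \<noteq> 0" "i < n" for r i
      using that hi[of i "pt p r"] by (auto simp: label_def pt_def p_def split: if_splits)
    have "\<exists>a b. g i a \<le> 0 \<and> 0 \<le> g i b \<and> (\<forall>j. \<bar>a j - pt p q j\<bar> \<le> 1 / real (Suc m)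
             \<and> \<bar>b j - pt p q j\<bar> \<le> 1 / real (Suc m))" if i: "i < n" for i
    proof -
      obtain r s where r: "\<forall>j<n. q j \<le> r j \<and> r j \<le> q j + 1"
        and s: "\<forall>j<n. q j \<le> s j \<and> s j \<le> q j + 1" and ne: "label r i \<noteq> label s i"
        using rs[THEN spec, THEN mp, OF i] by (elim exE conjE)
      have "label x i = 0 \<or> label x i = 1" for x by (simp add: label_def)
      then consider "label r i = 0" "label s i \<noteq> 0" | "label r i \<noteq> 0" "label s i = 0"
        using ne by metis
      then show ?thesis
      proof cases
        case 1
        then show ?thesis using near[OF r] near[OF s] label0[of r i] label1[of s i] i
          by (intro exI[of _ "pt p r"] exI[of _ "pt p s"]) simp
      next
        case 2
        then show ?thesis using near[OF r] near[OF s] label0[of s i] label1[of r i] i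
          by (intro exI[of _ "pt p s"] exI[of _ "pt p r"]) simp
      qed
    qed
    then obtain P N where PN: "\<And>i. i < n \<Longrightarrow> g i (P i) \<le> 0 \<and> 0 \<le> g i (N i) \<and>
        (\<forall>j. \<bar>P i j - pt p q j\<bar> \<le> 1 / real (Suc m) \<and> \<bar>N i j - pt p q j\<bar> \<le> 1 / real (Suc m))"
      by metis
    moreover have "0 \<le> pt p q j \<and> pt p q j \<le> 1" for j
      using q[rule_format, of j] by (auto simp: pt_def p_def)
    ultimately show ?thesis by (intro exI[of _ "pt p q"] exI[of _ P] exI[of _ N]) simp
  qed
  \<comment> \<open>The corner \<open>Q m\<close> does not depend on \<open>i\<close>, so the
    witnesses for all \<open>i\<close> converge to one and the same point.\<close>
  then obtain Q P N where Q: "\<And>m j. 0 \<le> Q m j \<and> Q m j \<le> (1::real)"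
    and PN: "\<And>m i. i < n \<Longrightarrow> g i (P m i) \<le> 0 \<and> 0 \<le> g i (N m i) \<and>
             (\<forall>j. \<bar>P m i j - Q m j\<bar> \<le> 1 / real (Suc m) \<and> \<bar>N m i j - Q m j\<bar> \<le> 1 / real (Suc m))"
    by metis
  \<comment> \<open>The points are sequences, so compactness of the cube is Tychonoff's theorem; the
    countable product is metrizable, which gives a convergent subsequence.\<close>
  have "compact (Pi\<^sub>E (UNIV::nat set) (\<lambda>_. {0..1::real}))"
    using compactin_PiE[of "\<lambda>_. euclideanreal" UNIV "\<lambda>_. {0..1}"]
    by (simp add: euclidean_product_topology)
  moreover have "Q m \<in> Pi\<^sub>E UNIV (\<lambda>_. {0..1})" for m using Q by auto
  ultimately obtain x \<sigma> where \<sigma>: "strict_mono (\<sigma> :: nat \<Rightarrow> nat)" and lim: "(Q \<circ> \<sigma>) \<longlonglongrightarrow> x"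
    unfolding compact_eq_seq_compact_metric seq_compact_def by metis
  have coord: "(\<lambda>m. Q (\<sigma> m) j) \<longlonglongrightarrow> x j" for j
    using lim limitin_componentwise[of "\<lambda>_. euclideanreal" UNIV "Q \<circ> \<sigma>" x sequentially]
    by (simp add: euclidean_product_topology)
  have inv: "(\<lambda>m. 1 / real (Suc (\<sigma> m))) \<longlonglongrightarrow> 0"
    using LIMSEQ_subseq_LIMSEQ[OF LIMSEQ_inverse_real_of_nat \<sigma>] by (simp add: o_def inverse_eq_divide)
  have tends: "(\<lambda>m. R (\<sigma> m)) \<longlonglongrightarrow> x" if "\<And>m j. \<bar>R m j - Q m j\<bar> \<le> 1 / real (Suc m)" for R
  proof -
    have "(\<lambda>m. R (\<sigma> m) j) \<longlonglongrightarrow> x j" for j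
    proof -
      have "(\<lambda>m. R (\<sigma> m) j - Q (\<sigma> m) j) \<longlonglongrightarrow> 0"
        by (rule Lim_null_comparison[OF _ inv]) (use that in simp)
      from tendsto_add[OF this coord[of j]] show ?thesis by simp
    qed
    then show ?thesis
      using limitin_componentwise[of "\<lambda>_. euclideanreal" UNIV "\<lambda>m. R (\<sigma> m)" x sequentially]
      by (simp add: euclidean_product_topology)
  qed
  have "g i x = 0" if "i < n" for i
  proof (rule antisym)
    have gl: "(\<lambda>m. g i (R (\<sigma> m))) \<longlonglongrightarrow> g i x" if "\<And>m j. \<bar>R m j - Q m j\<bar> \<le> 1 / real (Suc m)" for R
      using continuous_on_tendsto_compose[OF cont[OF \<open>i < n\<close>] tends[OF that]] by simp
    show "g i x \<le> 0"
      by (rule LIMSEQ_le_const2[OF gl[of "\<lambda>m. P m i"]]) (use PN[OF that] in auto)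
    show "0 \<le> g i x"
      by (rule LIMSEQ_le_const[OF gl[of "\<lambda>m. N m i"]]) (use PN[OF that] in auto)
  qed
  then show ?thesis by blast
qed

section \<open>A lower bound for the category of a map\<close>

text \<open>Nearby slices of the homotopy have a quotient close to 1, whose principal logarithm
  corrects a lift of one slice to a lift of the other. Hence liftability is locally constant in
  \<open>t\<close>, and it spreads from the constant slice at 1 to the slice at 0.\<close>

lemma circle_homotopy_lift:
  fixes k :: "real \<times> 'a \<Rightarrow> complex"
  assumes C: "compact_space C"
    and contk: "continuous_map (prod_topology (top_of_set {0..1}) C) euclidean k"
    and norm1: "\<And>t x. \<lbrakk>t \<in> {0..1}; x \<in> topspace C\<rbrakk> \<Longrightarrow> norm (k (t,x)) = 1"
    and k1: "\<And>x. x \<in> topspace C \<Longrightarrow> k (1,x) = c"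
  shows "\<exists>g. continuous_map C euclideanreal g \<and> (\<forall>x\<in>topspace C. k (0,x) = cis (g x))"
proof -
  define P where "P t \<longleftrightarrow> (\<exists>g. continuous_map C euclideanreal g \<and> (\<forall>x\<in>topspace C. k (t,x) = cis (g x)))" for t
  have slice: "continuous_map C euclidean (\<lambda>x. k (t,x))" if "t \<in> {0..1}" for t
  proof -
    have "continuous_map C (prod_topology (top_of_set {0..1}) C) (\<lambda>x. (t,x))"
      using that by (intro continuous_map_pairedI) auto
    from continuous_map_compose[OF this contk] show ?thesis by (simp add: o_def)
  qed
  have "P 0"
  proof (rule connected_induction_simple[of "{0..1::real}" 1])
    show "P 1"
    proof (cases "topspace C = {}")
      case False
      then have "norm c = 1" using norm1[of 1] k1 by fastforce
      moreover from this have "c \<noteq> 0" by auto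
      ultimately have "c = cis (Arg c)" by (simp add: cis_Arg sgn_eq)
      then show ?thesis unfolding P_def using k1
        by (intro exI[of _ "\<lambda>_. Arg c"]) simp
    qed (auto simp: P_def)
  next
    fix a :: real assume a: "a \<in> {0..1}"
    \<comment> \<open>Compactness of \<open>C\<close> enters here: the tube lemma makes the bound
      1/2 uniform over a neighbourhood \<open>U\<close> of \<open>a\<close>. Any two slices over
      \<open>U\<close> then differ by less than 1.\<close>
    define W where "W = {z \<in> topspace (prod_topology (top_of_set {0..1}) C). norm (k z - k (a, snd z)) \<in> {..<1/2}}"
    have "continuous_map (prod_topology (top_of_set {0..1}) C) euclidean (\<lambda>z. k (a, snd z))"
      using continuous_map_compose[OF continuous_map_snd slice[OF a]] by (simp add: o_def)
    then have "continuous_map (prod_topology (top_of_set {0..1}) C) euclideanreal (\<lambda>z. norm (k z - k (a, snd z)))"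
      using contk by (intro continuous_intros)
    then have "openin (prod_topology (top_of_set {0..1}) C) W"
      unfolding W_def by (rule openin_continuous_map_preimage) simp
    moreover have "{a} \<times> topspace C \<subseteq> W" using a by (auto simp: W_def)
    ultimately obtain U V where U: "openin (top_of_set {0..1}) U" "a \<in> U"
      and UV: "topspace C \<subseteq> V" "U \<times> V \<subseteq> W"
      using tube_lemma_right[of "top_of_set {0..1}" C W "topspace C" a] C a
      by (auto simp: compact_space_def)
    have "P t'" if t: "t \<in> U" and t': "t' \<in> U" and "P t" for t t'
    proof -
      obtain g where g: "continuous_map C euclideanreal g" "\<And>x. x \<in> topspace C \<Longrightarrow> k (t,x) = cis (g x)"
        using \<open>P t\<close> unfolding P_def by blast
      have U01: "t \<in> {0..1}" "t' \<in> {0..1}" using t t' openin_imp_subset[OF U(1)] by blast+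
      \<comment> \<open>On the unit circle the conjugate is the inverse, so \<open>q\<close> is the
        quotient of the two slices.\<close>
      define q where "q x = k (t',x) * cnj (k (t,x))" for x
      have q1: "norm (q x) = 1" if "x \<in> topspace C" for x
        using norm1[OF U01(1) that] norm1[OF U01(2) that] by (simp add: q_def norm_mult)
      have qpos: "q x \<notin> \<real>\<^sub>\<le>\<^sub>0" if x: "x \<in> topspace C" for x
      proof -
        have "norm (k (t,x) - k (a,x)) < 1/2" "norm (k (t',x) - k (a,x)) < 1/2"
          using subsetD[OF UV(2), of "(t,x)"] subsetD[OF UV(2), of "(t',x)"] t t' x UV(1)
          by (auto simp: W_def)
        then have lt: "norm (k (t',x) - k (t,x)) < 1" by norm
        have "k (t,x) * cnj (k (t,x)) = 1"
          using norm1[OF U01(1) x] by (simp add: complex_norm_square[symmetric])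
        then have "q x - 1 = (k (t',x) - k (t,x)) * cnj (k (t,x))"
          by (simp add: q_def algebra_simps)
        then have "norm (q x - 1) < 1" using lt norm1[OF U01(1) x] by (simp add: norm_mult)
        then have "\<bar>Re (q x - 1)\<bar> < 1" using abs_Re_le_cmod[of "q x - 1"] by linarith
        then show ?thesis by (auto simp: complex_nonpos_Reals_iff)
      qed
      have "continuous_map C euclidean q"
        unfolding q_def
        using slice[OF U01(1)] slice[OF U01(2)] by (simp add: continuous_map_atin tendsto_mult tendsto_cnj)
      then have "continuous_map C (top_of_set (- \<real>\<^sub>\<le>\<^sub>0)) q"
        using qpos by (auto simp: continuous_map_in_subtopology)
      moreover have "continuous_map (top_of_set (- \<real>\<^sub>\<le>\<^sub>0)) euclideanreal (\<lambda>z. Im (Ln z))"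
        by (auto intro!: continuous_intros)
      ultimately have "continuous_map C euclideanreal (\<lambda>x. Im (Ln (q x)))"
        by (rule continuous_map_compose[unfolded o_def])
      moreover have "k (t',x) = cis (g x + Im (Ln (q x)))" if x: "x \<in> topspace C" for x
      proof -
        have "q x \<noteq> 0" using q1[OF x] by auto
        then have "exp (Ln (q x)) = q x" "Re (Ln (q x)) = 0" using q1[OF x] by simp_all
        then have "cis (Im (Ln (q x))) = q x"
          using exp_eq_polar[of "Ln (q x)"] by simp
        moreover have "k (t,x) * cnj (k (t,x)) = 1"
          using norm1[OF U01(1) x] by (simp add: complex_norm_square[symmetric])
        ultimately show ?thesis using g(2)[OF x]
          by (simp add: q_def cis_mult[symmetric] mult.commute mult.left_commute)
      qed
      ultimately show ?thesis unfolding P_def using g(1)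
        by (intro exI[of _ "\<lambda>x. g x + Im (Ln (q x))"]) (auto intro: continuous_map_add)
    qed
    then show "\<exists>T. openin (top_of_set {0..1}) T \<and> a \<in> T \<and> (\<forall>x\<in>T. \<forall>y\<in>T. P x \<longrightarrow> P y)"
      using U by blast
  qed auto
  then show ?thesis by (simp add: P_def)
qed

text \<open>By regularity each point has a closed neighbourhood inside a member of the cover.
  Finitely many of these cover the space, and they are grouped by the member containing
  them.\<close>

lemma finite_open_cover_shrink:
  assumes X: "compact_space X" "Hausdorff_space X"
    and op: "\<And>i. i \<in> I \<Longrightarrow> openin X (A i)" and cov: "topspace X \<subseteq> (\<Union>i\<in>I. A i)"
  obtains C where "\<And>i. i \<in> I \<Longrightarrow> closedin X (C i)" "\<And>i. i \<in> I \<Longrightarrow> C i \<subseteq> A i"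
    "topspace X = (\<Union>i\<in>I. C i)"
proof -
  have nb: "neighbourhood_base_of (closedin X) X"
    using X compact_Hausdorff_imp_regular_space neighbourhood_base_of_closedin by blast
  have "\<exists>i U V. i \<in> I \<and> openin X U \<and> closedin X V \<and> x \<in> U \<and> U \<subseteq> V \<and> V \<subseteq> A i" if "x \<in> topspace X" for x
  proof -
    obtain i where "i \<in> I" "x \<in> A i" using cov \<open>x \<in> topspace X\<close> by blast
    then show ?thesis
      using nb op[of i] unfolding neighbourhood_base_of by metis
  qed
  then obtain i U V where iUV: "\<And>x. x \<in> topspace X \<Longrightarrow>
      i x \<in> I \<and> openin X (U x) \<and> closedin X (V x) \<and> x \<in> U x \<and> U x \<subseteq> V x \<and> V x \<subseteq> A (i x)"
    by metis
  obtain \<F> where "finite \<F>" "\<F> \<subseteq> U ` topspace X" "topspace X \<subseteq> \<Union>\<F>"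
    using X(1) iUV unfolding compact_space_alt
    by (smt (verit, best) UN_iff imageE subsetI)
  then obtain D where D: "finite D" "D \<subseteq> topspace X" "topspace X \<subseteq> (\<Union>x\<in>D. U x)"
    by (metis finite_subset_image)
  define C where "C j = (\<Union>x\<in>{x\<in>D. i x = j}. V x)" for j
  show thesis
  proof
    show "closedin X (C j)" if "j \<in> I" for j
      unfolding C_def using D iUV by (intro closedin_Union) auto
    then have "(\<Union>j\<in>I. C j) \<subseteq> topspace X" by (auto dest: closedin_subset)
    moreover have "topspace X \<subseteq> (\<Union>j\<in>I. C j)"
    proof
      fix y assume "y \<in> topspace X"
      then obtain x where "x \<in> D" "y \<in> U x" using D(3) by blast
      then show "y \<in> (\<Union>j\<in>I. C j)" using iUV[of x] D(2) by (auto simp: C_def)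
    qed
    ultimately show "topspace X = (\<Union>j\<in>I. C j)" by blast
    show "C j \<subseteq> A j" if "j \<in> I" for j
      using D(2) iUV unfolding C_def by blast
  qed
qed

text \<open>\<open>E\<close> plays the role of the universal covering of a torus in
  \<open>X\<close>, and the \<open>e i\<close> are circle coordinates on \<open>Y\<close>. The
  functions \<open>h i \<circ> E\<close> live on the angles themselves, where a box is available for
  the Poincare-Miranda theorem.\<close>

lemma no_categorical_cover_torus:
  fixes E :: "(nat \<Rightarrow> real) \<Rightarrow> 'a" and e :: "nat \<Rightarrow> 'b \<Rightarrow> complex"
  assumes X: "compact_space X" "Hausdorff_space X"
    and cat: "\<And>i. i < n \<Longrightarrow> map_categorical X Y \<phi> (A i)" and cov: "topspace X = (\<Union>i<n. A i)"
    and conte: "\<And>i. i < n \<Longrightarrow> continuous_map Y euclidean (e i)"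
    and norme: "\<And>i y. \<lbrakk>i < n; y \<in> topspace Y\<rbrakk> \<Longrightarrow> norm (e i y) = 1"
    and contE: "continuous_map euclidean X E"
    and sec: "\<And>i \<theta>. i < n \<Longrightarrow> e i (\<phi> (E \<theta>)) = cis (\<theta> i)"
  shows False
proof -
  obtain C where C: "\<And>i. i \<in> {..<n} \<Longrightarrow> closedin X (C i)" "\<And>i. i \<in> {..<n} \<Longrightarrow> C i \<subseteq> A i"
    "topspace X = (\<Union>i\<in>{..<n}. C i)"
  proof (rule finite_open_cover_shrink[OF X, of "{..<n}" A])
    show "\<And>i. i \<in> {..<n} \<Longrightarrow> openin X (A i)" using cat by (simp add: map_categorical_def)
  qed (use cov in auto)
  have "\<exists>h B. continuous_map X euclideanreal h \<and> (\<forall>x\<in>topspace X. \<bar>h x\<bar> \<le> B) \<and>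
          (\<forall>x\<in>C i. e i (\<phi> x) = cis (h x))" if i: "i < n" for i
  proof -
    obtain c H where contH: "continuous_map (prod_topology (top_of_set {0..1::real}) (subtopology X (A i))) Y H"
      and H: "\<forall>x. H (0,x) = \<phi> x" "\<forall>x. H (1,x) = c"
      using cat[OF i] unfolding map_categorical_def homotopic_with_def by blast
    let ?C = "subtopology X (C i)"
    have subC: "C i \<subseteq> topspace X" using C(1)[of i] i by (auto dest: closedin_subset)
    \<comment> \<open>The homotopy is restricted to the closed set \<open>C i\<close> because the
      lifting lemma needs a compact domain.\<close>
    have contH': "continuous_map (prod_topology (top_of_set {0..1}) ?C) Y H"
      using continuous_map_from_subtopology[OF contH, of "{0..1} \<times> C i"] C(2)[of i] i
      by (simp add: subtopology_Times subtopology_subtopology Int_absorb1 flip: prod_topology_subtopology)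
    have compC: "compactin X (C i)" using closedin_compact_space[OF X(1)] C(1)[of i] i by simp
    have HY: "H (t,x) \<in> topspace Y" if "t \<in> {0..1}" "x \<in> C i" for t x
      using continuous_map_image_subset_topspace[OF contH'] that subC
      by (auto simp: image_subset_iff)
    have "\<exists>g. continuous_map ?C euclideanreal g \<and> (\<forall>x\<in>topspace ?C. (e i \<circ> H) (0,x) = cis (g x))"
    proof (rule circle_homotopy_lift)
      show "compact_space ?C" using compC by (simp add: compact_space_subtopology)
      show "continuous_map (prod_topology (top_of_set {0..1}) ?C) euclidean (e i \<circ> H)"
        by (rule continuous_map_compose[OF contH' conte[OF i]])
    qed (use H HY norme[OF i] in auto)
    then obtain g where g: "continuous_map ?C euclideanreal g" "\<And>x. x \<in> C i \<Longrightarrow> e i (\<phi> x) = cis (g x)"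
      using subC H by (auto simp: inf.absorb2)
    have "compactin ?C (C i)" using compC by (simp add: compactin_subtopology)
    from image_compactin[OF this g(1)] have "bounded (g ` C i)"
      by (simp add: compact_imp_bounded)
    then obtain B where B: "\<And>x. x \<in> C i \<Longrightarrow> \<bar>g x\<bar> \<le> B" "B \<ge> 0"
      unfolding bounded_iff by (metis abs_ge_zero image_eqI linorder_le_cases order_trans real_norm_def)
    have "normal_space X" using X by (simp add: compact_Hausdorff_or_regular_imp_normal_space)
    then obtain h where "continuous_map X euclideanreal h"
      "\<And>x. x \<in> C i \<Longrightarrow> h x = g x" "h ` topspace X \<subseteq> {-B..B}"
    proof (rule Tietze_extension_closed_real_interval)
      show "closedin X (C i)" using C(1) i by simp
      show "g ` C i \<subseteq> {-B..B}" using B(1) by (auto simp: abs_le_iff minus_le_iff)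
    qed (use g(1) B(2) in auto)
    then show ?thesis using g(2) by (intro exI[of _ h] exI[of _ B]) (auto simp: abs_le_iff minus_le_iff image_subset_iff)
  qed
  then obtain h B where h: "\<And>i. i < n \<Longrightarrow> continuous_map X euclideanreal (h i)"
      "\<And>i x. \<lbrakk>i < n; x \<in> topspace X\<rbrakk> \<Longrightarrow> \<bar>h i x\<bar> \<le> B i" "\<And>i x. \<lbrakk>i < n; x \<in> C i\<rbrakk> \<Longrightarrow> e i (\<phi> x) = cis (h i x)"
    by metis
  \<comment> \<open>The unit cube is stretched to the box of half-width \<open>B i + pi\<close>. On
    its faces the bound on \<open>h i\<close> gives
    \<open>\<theta> u i - h i (E (\<theta> u)) - pi\<close> the signs required.\<close>
  define \<theta> where "\<theta> u = (\<lambda>i. (B i + pi) * (2 * u i - 1))" for u :: "nat \<Rightarrow> real"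
  have E: "E \<theta> \<in> topspace X" for \<theta>
    using continuous_map_image_subset_topspace[OF contE] by auto
  have "\<exists>u. \<forall>i<n. \<theta> u i - h i (E (\<theta> u)) - pi = 0"
  proof (rule poincare_miranda)
    fix i assume i: "i < n"
    have "continuous_on UNIV \<theta>" unfolding \<theta>_def
      by (intro continuous_on_coordinatewise_then_product continuous_intros continuous_on_product_coordinates)
    moreover have "continuous_on UNIV (\<lambda>v. h i (E v))"
      using continuous_map_compose[OF contE h(1)[OF i]] by (simp add: o_def)
    ultimately have "continuous_on UNIV (\<lambda>u. h i (E (\<theta> u)))" "continuous_on UNIV (\<lambda>u. \<theta> u i)"
      by (auto intro: continuous_on_compose2[of UNIV _ UNIV \<theta>] continuous_on_product_then_coordinatewise)
    then show "continuous_on UNIV (\<lambda>u. \<theta> u i - h i (E (\<theta> u)) - pi)"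
      by (intro continuous_on_diff continuous_on_const)
    fix u :: "nat \<Rightarrow> real"
    show "u i = 0 \<Longrightarrow> \<theta> u i - h i (E (\<theta> u)) - pi \<le> 0"
      using h(2)[OF i E, of "\<theta> u"] by (simp add: \<theta>_def) (insert pi_gt_zero, linarith)
    show "u i = 1 \<Longrightarrow> 0 \<le> \<theta> u i - h i (E (\<theta> u)) - pi"
      using h(2)[OF i E, of "\<theta> u"] by (simp add: \<theta>_def)
  qed
  then obtain u where "\<forall>i<n. \<theta> u i - h i (E (\<theta> u)) - pi = 0" by blast
  then have u: "\<theta> u i = h i (E (\<theta> u)) + pi" if "i < n" for i
    using that by (simp add: diff_diff_eq)
  obtain i where i: "i < n" "E (\<theta> u) \<in> C i" using E C(3) by blast
  \<comment> \<open>On \<open>C i\<close> the angle and the lift have the same \<open>cis\<close>,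
    while the common zero makes them differ by \<open>pi\<close>, which negates
    \<open>cis\<close>.\<close>
  have "cis (h i (E (\<theta> u))) = cis (\<theta> u i)"
    using h(3)[OF i] sec[OF i(1)] by simp
  then show False using u[OF i(1)] by (simp add: cis_mult[symmetric])
qed

section \<open>The round disc and the cube\<close>

text \<open>Recursion gives the value 0 in dimension 0, where a maximum over the empty index set
  would be unspecified.\<close>

primrec sup_norm :: "nat \<Rightarrow> (nat \<Rightarrow> real) \<Rightarrow> real" where
  "sup_norm 0 y = 0"
| "sup_norm (Suc n) y = max (sup_norm n y) \<bar>y n\<bar>"

definition l2_norm :: "nat \<Rightarrow> (nat \<Rightarrow> real) \<Rightarrow> real" where
  "l2_norm n y = sqrt (\<Sum>i<n. (y i)\<^sup>2)"

text \<open>At the origin the quotient is \<open>0 / 0 = 0\<close>, which is the continuous extension.\<close>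

definition disc_to_cube :: "nat \<Rightarrow> (nat \<Rightarrow> real) \<Rightarrow> nat \<Rightarrow> real" where
  "disc_to_cube n y i = y i * l2_norm n y / sup_norm n y"

section \<open>Elementary properties of the two norms\<close>

lemma sup_norm_nonneg: "0 \<le> sup_norm n y"
  by (induction n) auto

lemma abs_le_sup_norm: "i < n \<Longrightarrow> \<bar>y i\<bar> \<le> sup_norm n y"
  by (induction n) (auto simp: less_Suc_eq le_max_iff_disj)

lemma sup_norm_less_iff: "sup_norm n y < c \<longleftrightarrow> 0 < c \<and> (\<forall>i<n. \<bar>y i\<bar> < c)"
  by (induction n) (auto simp: less_Suc_eq)

lemma sup_norm_attained: "0 < sup_norm n y \<Longrightarrow> \<exists>i<n. \<bar>y i\<bar> = sup_norm n y"
proof (induction n)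
  case (Suc n)
  then show ?case
    by (cases "sup_norm n y \<le> \<bar>y n\<bar>") (fastforce simp: less_Suc_eq max_def)+
qed simp

lemma sup_norm_eq_0_iff: "sup_norm n y = 0 \<longleftrightarrow> (\<forall>i<n. y i = 0)"
proof
  show "sup_norm n y = 0 \<Longrightarrow> \<forall>i<n. y i = 0" by (metis abs_le_sup_norm abs_le_zero_iff)
  show "\<forall>i<n. y i = 0 \<Longrightarrow> sup_norm n y = 0" by (induction n) auto
qed

lemma sup_norm_scale: "sup_norm n (\<lambda>i. y i * c) = sup_norm n y * \<bar>c\<bar>"
proof (induction n)
  case (Suc n)
  have "max a b * \<bar>c\<bar> = max (a * \<bar>c\<bar>) (b * \<bar>c\<bar>)" for a b :: real
    by (metis abs_ge_zero max_mult_distrib_right)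
  then show ?case by (simp only: sup_norm.simps Suc abs_mult)
qed simp

lemma sup_norm_cong: "(\<And>i. i < n \<Longrightarrow> y i = z i) \<Longrightarrow> sup_norm n y = sup_norm n z"
  by (induction n) auto

lemma l2_norm_nonneg: "0 \<le> l2_norm n y"
  by (simp add: l2_norm_def sum_nonneg)

lemma l2_norm_eq_0_iff: "l2_norm n y = 0 \<longleftrightarrow> (\<forall>i<n. y i = 0)"
  by (simp add: l2_norm_def sum_nonneg_eq_0_iff Ball_def)

lemma sup_norm_eq_0_iff_l2: "sup_norm n y = 0 \<longleftrightarrow> l2_norm n y = 0"
  unfolding sup_norm_eq_0_iff l2_norm_eq_0_iff ..

lemma l2_norm_scale: "l2_norm n (\<lambda>i. y i * c) = l2_norm n y * \<bar>c\<bar>"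
  by (simp only: l2_norm_def power_mult_distrib real_sqrt_mult sum_distrib_right[symmetric] real_sqrt_abs)

lemma l2_norm_cong: "(\<And>i. i < n \<Longrightarrow> y i = z i) \<Longrightarrow> l2_norm n y = l2_norm n z"
  by (simp add: l2_norm_def)

lemma continuous_on_coordinate:
  fixes S :: "('a \<Rightarrow> 'b::topological_space) set"
  shows "continuous_on S (\<lambda>x. x i)"
  by (rule continuous_on_subset[OF continuous_on_product_coordinates subset_UNIV])

lemma continuous_on_sup_norm: "continuous_on S (sup_norm n)"
proof (induction n)
  case (Suc n)
  have "sup_norm (Suc n) = (\<lambda>y. max (sup_norm n y) \<bar>y n\<bar>)" by (simp add: fun_eq_iff)
  then show ?case
    by (simp only:) (rule continuous_on_max[OF Suc continuous_on_rabs[OF continuous_on_coordinate]])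
next
  case 0
  have "sup_norm 0 = (\<lambda>_. 0)" by (simp add: fun_eq_iff)
  then show ?case by simp
qed

lemma continuous_on_l2_norm: "continuous_on S (l2_norm n)"
  unfolding l2_norm_def
  by (intro continuous_on_real_sqrt continuous_on_sum continuous_on_power continuous_on_coordinate)

text \<open>The rescaling is radial and carries the round sphere of radius r to the boundary of the
  cube of half-width r. The domination estimate, injectivity and the description of the boundary all
  rest on this identity.\<close>

lemma sup_norm_disc_to_cube: "sup_norm n (disc_to_cube n y) = l2_norm n y"
proof (cases "sup_norm n y = 0")
  case True
  then have "l2_norm n y = 0" by (simp add: sup_norm_eq_0_iff_l2)
  then show ?thesis by (auto simp: disc_to_cube_def sup_norm_eq_0_iff)
next
  case False
  have "disc_to_cube n y = (\<lambda>i. y i * (l2_norm n y / sup_norm n y))"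
    by (simp add: disc_to_cube_def fun_eq_iff)
  then have "sup_norm n (disc_to_cube n y) = sup_norm n y * \<bar>l2_norm n y / sup_norm n y\<bar>"
    by (simp only: sup_norm_scale)
  then show ?thesis using False by (simp add: l2_norm_nonneg sup_norm_nonneg)
qed

lemma continuous_disc_to_cube:
  assumes "i < n" shows "continuous_on S (\<lambda>y. disc_to_cube n y i)"
proof -
  have cs: "isCont (sup_norm n) y" and cl: "isCont (l2_norm n) y" for y
    using continuous_on_sup_norm[of UNIV] continuous_on_l2_norm[of UNIV]
    by (auto simp: continuous_on_eq_continuous_at)
  have "isCont (\<lambda>y. disc_to_cube n y i) y" for y
  proof (cases "sup_norm n y = 0")
    case False
    have "isCont (\<lambda>y. y i) y"
      using continuous_on_interior[OF continuous_on_coordinate[of UNIV i], of y] by simp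
    then show ?thesis
      unfolding disc_to_cube_def using False cs cl by (intro continuous_intros)
  next
    \<comment> \<open>Where the first \<open>n\<close> coordinates vanish the quotient is singular,
      but each coordinate is dominated by \<open>l2_norm n\<close>, which tends to 0 there.\<close>
    case True
    then have l0: "l2_norm n y = 0" by (simp add: sup_norm_eq_0_iff_l2)
    have "norm (disc_to_cube n z i) \<le> l2_norm n z" for z
      using abs_le_sup_norm[OF assms, of "disc_to_cube n z"] by (simp add: sup_norm_disc_to_cube)
    moreover have "(l2_norm n \<longlongrightarrow> 0) (at y)" using cl[of y] l0 by (simp add: isCont_def)
    ultimately have "((\<lambda>z. disc_to_cube n z i) \<longlongrightarrow> 0) (at y)"
      by (rule Lim_null_comparison[OF always_eventually[OF allI]])
    then show ?thesis using l0 by (simp add: isCont_def disc_to_cube_def)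
  qed
  then show ?thesis by (simp add: continuous_at_imp_continuous_on)
qed

text \<open>Equal images have equal round norms, and \<open>y\<close> is a nonnegative multiple of
  \<open>z\<close> in the first \<open>n\<close> coordinates; equal nonzero norms force the factor
  1.\<close>

lemma disc_to_cube_inj:
  assumes eq: "\<And>i. i < n \<Longrightarrow> disc_to_cube n y i = disc_to_cube n z i" and "i < n"
  shows "y i = z i"
proof -
  have l: "l2_norm n y = l2_norm n z"
    using sup_norm_cong[of n "disc_to_cube n y" "disc_to_cube n z"] eq
    by (simp add: sup_norm_disc_to_cube)
  show ?thesis
  proof (cases "l2_norm n y = 0")
    case True
    then show ?thesis using l l2_norm_eq_0_iff[of n y] l2_norm_eq_0_iff[of n z] \<open>i < n\<close> by simp
  next
    case False
    have sy: "sup_norm n y \<noteq> 0" and sz: "sup_norm n z \<noteq> 0"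
      using False l by (simp_all add: sup_norm_eq_0_iff_l2)
    define c where "c = sup_norm n y / sup_norm n z"
    have yz: "y j = z j * c" if "j < n" for j
      using eq[OF that] False l sy sz by (simp add: disc_to_cube_def c_def field_simps)
    then have "l2_norm n z * \<bar>c\<bar> = l2_norm n z"
      using l2_norm_cong[of n y "\<lambda>j. z j * c"] l by (simp add: l2_norm_scale)
    moreover have "c \<ge> 0" by (simp add: c_def sup_norm_nonneg)
    ultimately have "c = 1" using False l by simp
    then show ?thesis using yz[OF \<open>i < n\<close>] by simp
  qed
qed

lemma disc_to_cube_surj:
  assumes "sup_norm n a < 1"
  obtains y where "y \<in> open_disc n" "\<And>i. i < n \<Longrightarrow> disc_to_cube n y i = a i"
proof -
  \<comment> \<open>The inverse map scales by the reciprocal ratio of the norms.\<close>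
  define c where "c = sup_norm n a / l2_norm n a"
  define y where "y i = (if i < n then a i * c else 0)" for i
  have c0: "c \<ge> 0" by (simp add: c_def sup_norm_nonneg l2_norm_nonneg)
  have l: "l2_norm n y = l2_norm n a * c" and s: "sup_norm n y = sup_norm n a * c"
    using l2_norm_cong[of n y "\<lambda>i. a i * c"] sup_norm_cong[of n y "\<lambda>i. a i * c"] c0
    by (auto simp: y_def l2_norm_scale sup_norm_scale)
  have zero_iff: "l2_norm n a = 0 \<longleftrightarrow> sup_norm n a = 0"
    by (simp add: sup_norm_eq_0_iff_l2)
  then have "l2_norm n y = sup_norm n a" by (simp add: l c_def)
  then have "l2_norm n y < 1" using assms by simp
  then have "y \<in> open_disc n"
    by (simp add: open_disc_def topspace_Euclidean_space l2_norm_def y_def)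
  moreover have "disc_to_cube n y i = a i" if "i < n" for i
  proof (cases "sup_norm n a = 0")
    case True
    then show ?thesis using that by (simp add: sup_norm_eq_0_iff disc_to_cube_def y_def)
  next
    case False
    then have "c \<noteq> 0" using zero_iff by (simp add: c_def)
    then show ?thesis
      using False zero_iff \<open>l2_norm n y = sup_norm n a\<close> that by (simp add: disc_to_cube_def s y_def)
  qed
  ultimately show thesis using that by blast
qed

text \<open>The disc is a closed subset of a product of intervals \<open>{-1..1}\<close>, compact by
  Tychonoff.\<close>

lemma compact_closed_disc: "compactin (Euclidean_space n) (closed_disc n)"
proof -
  define B where "B = Pi\<^sub>E UNIV (\<lambda>_::nat. {-1..1::real})"
  have "compact B"
    using compactin_PiE[of "\<lambda>_. euclideanreal" UNIV "\<lambda>_. {-1..1}"]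
    by (simp add: B_def euclidean_product_topology)
  moreover have "closed {x. l2_norm n x \<le> 1}"
    by (intro closed_Collect_le continuous_on_l2_norm continuous_on_const)
  moreover have "closed (topspace (Euclidean_space n))"
    using closedin_Euclidean_space by (simp add: euclidean_product_topology)
  moreover have "closed_disc n \<subseteq> B"
  proof
    fix x assume x: "x \<in> closed_disc n"
    have "\<bar>x i\<bar> \<le> 1" for i
    proof (cases "i < n")
      case True
      have "(x i)\<^sup>2 \<le> (\<Sum>i<n. (x i)\<^sup>2)"
        using True by (intro member_le_sum) auto
      also have "\<dots> \<le> 1" using x by (simp add: closed_disc_def)
      finally show ?thesis by (simp add: abs_square_le_1)
    qed (use x in \<open>simp add: closed_disc_def topspace_Euclidean_space\<close>)
    then show "x \<in> B" by (auto simp: B_def abs_le_iff minus_le_iff)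
  qed
  then have "closed_disc n = B \<inter> ({x. l2_norm n x \<le> 1} \<inter> topspace (Euclidean_space n))"
    by (auto simp: closed_disc_def l2_norm_def)
  ultimately have "compact (closed_disc n)" by (metis compact_Int_closed closed_Int)
  then show ?thesis
    unfolding Euclidean_space_def
    by (auto simp: compactin_subtopology euclidean_product_topology closed_disc_def topspace_Euclidean_space)
qed

section \<open>Subcomplexes of a torus\<close>

text \<open>The space is a finite union of continuous images of compact closed discs.\<close>

lemma finite_CW_structure_imp_compact_space:
  assumes "finite_CW_structure X I d \<Phi>" shows "compact_space X"
proof -
  have "compactin X (\<Phi> i ` closed_disc (d i)) \<and> open_disc (d i) \<subseteq> closed_disc (d i)" if "i \<in> I" for i
  proof
    have "compactin (subtopology (Euclidean_space (d i)) (closed_disc (d i))) (closed_disc (d i))"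
      by (simp add: compactin_subtopology compact_closed_disc)
    moreover have "continuous_map (subtopology (Euclidean_space (d i)) (closed_disc (d i))) X (\<Phi> i)"
      using assms that by (simp add: finite_CW_structure_def)
    ultimately show "compactin X (\<Phi> i ` closed_disc (d i))" by (rule image_compactin)
  qed (auto simp: open_disc_def closed_disc_def)
  note discs = this
  have top: "topspace X = (\<Union>i\<in>I. \<Phi> i ` open_disc (d i))" and fin: "finite I"
    using assms by (simp_all add: finite_CW_structure_def)
  have comp: "compactin X (\<Union>i\<in>I. \<Phi> i ` closed_disc (d i))"
    using fin discs by (intro compactin_Union) auto
  moreover have "topspace X \<subseteq> (\<Union>i\<in>I. \<Phi> i ` closed_disc (d i))"
    unfolding top using discs by (intro UN_mono image_mono) auto
  ultimately have "topspace X = (\<Union>i\<in>I. \<Phi> i ` closed_disc (d i))"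
    using compactin_subset_topspace by (intro subset_antisym)
  with comp show ?thesis
    by (simp add: compact_space_def)
qed

text \<open>The inverse is continuous because a map from the compact closed disc to \<open>X\<close> is closed.\<close>

lemma homeomorphic_map_open_disc:
  assumes "Hausdorff_space X"
    and cont: "continuous_map (subtopology (Euclidean_space n) (closed_disc n)) X \<Phi>"
    and inj: "inj_on \<Phi> (open_disc n)" and bd: "\<Phi> ` boundary_sphere n \<inter> \<Phi> ` open_disc n = {}"
  shows "homeomorphic_map (subtopology (Euclidean_space n) (open_disc n))
           (subtopology X (\<Phi> ` open_disc n)) \<Phi>"
proof -
  let ?D = "subtopology (Euclidean_space n) (closed_disc n)"
  have sub: "open_disc n \<subseteq> closed_disc n" "closed_disc n \<subseteq> topspace (Euclidean_space n)"
    "closed_disc n - open_disc n \<subseteq> boundary_sphere n"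
    by (auto simp: open_disc_def closed_disc_def boundary_sphere_def)
  have D: "subtopology ?D (open_disc n) = subtopology (Euclidean_space n) (open_disc n)"
    using sub by (simp add: subtopology_subtopology Int_absorb1)
  have topD: "topspace ?D = closed_disc n" using sub by (simp add: Int_absorb1)
  have "compact_space ?D" using compact_closed_disc by (simp add: compact_space_subtopology)
  then have "closed_map ?D X \<Phi>"
    using continuous_imp_closed_map_gen Hausdorff_imp_kc_space assms(1) cont by blast
  moreover have "{x \<in> topspace ?D. \<Phi> x \<in> \<Phi> ` open_disc n} = open_disc n"
    using sub bd topD by blast
  ultimately have cl: "closed_map (subtopology (Euclidean_space n) (open_disc n))
      (subtopology X (\<Phi> ` open_disc n)) \<Phi>"
    using closed_map_restriction[of ?D X \<Phi> "\<Phi> ` open_disc n" "open_disc n"] by (simp only: D)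
  have im: "\<Phi> ` open_disc n \<subseteq> topspace X"
    using continuous_map_image_subset_topspace[OF cont] sub topD by blast
  have top: "topspace (subtopology (Euclidean_space n) (open_disc n)) = open_disc n"
    using sub by auto
  have "continuous_map (subtopology (Euclidean_space n) (open_disc n)) (subtopology X (\<Phi> ` open_disc n)) \<Phi>"
    using continuous_map_from_subtopology[OF cont, of "open_disc n"] top D
    by (simp add: continuous_map_in_subtopology)
  then show ?thesis
    using cl top im inj by (intro bijective_closed_imp_homeomorphic_map) (auto simp: Int_absorb1)
qed

text \<open>
  \<open>torus_complex K\<close> is the polyhedral product of \<open>(S\<^sup>1, 1)\<close> over the simplicial complex \<open>K\<close>; the
  circle with index \<open>v\<close> occupies the real coordinates \<open>2v\<close> and \<open>2v + 1\<close>.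
\<close>

definition circle_coord :: "nat \<Rightarrow> (nat \<Rightarrow> real) \<Rightarrow> complex" where
  "circle_coord v x = Complex (x (2 * v)) (x (2 * v + 1))"

definition from_coords :: "(nat \<Rightarrow> complex) \<Rightarrow> nat \<Rightarrow> real" where
  "from_coords z m = (if even m then Re (z (m div 2)) else Im (z (m div 2)))"

text \<open>The circles have base point 1. The open cell of a face \<open>J\<close> will consist of
  the points with support exactly \<open>J\<close>.\<close>

definition torus_supp :: "(nat \<Rightarrow> real) \<Rightarrow> nat set" where
  "torus_supp x = {v. circle_coord v x \<noteq> 1}"

definition torus_complex :: "nat set set \<Rightarrow> (nat \<Rightarrow> real) topology" where
  "torus_complex K = top_of_set {x. (\<forall>v. norm (circle_coord v x) = 1) \<and> torus_supp x \<in> K}"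

section \<open>Circle coordinates and continuity\<close>

lemma circle_coord_from_coords [simp]: "circle_coord v (from_coords z) = z v"
  by (simp add: circle_coord_def from_coords_def)

lemma circle_coord_eqI: "(\<And>v. circle_coord v x = circle_coord v y) \<Longrightarrow> x = y"
proof
  fix m assume "\<And>v. circle_coord v x = circle_coord v y"
  then have "x (2 * (m div 2)) = y (2 * (m div 2)) \<and> x (2 * (m div 2) + 1) = y (2 * (m div 2) + 1)"
    unfolding circle_coord_def by (metis complex.inject)
  then show "x m = y m" by (cases "even m") auto
qed

lemma topspace_torus_complex:
  "topspace (torus_complex K) = {x. (\<forall>v. norm (circle_coord v x) = 1) \<and> torus_supp x \<in> K}"
  by (simp add: torus_complex_def)

lemma Hausdorff_space_torus_complex: "Hausdorff_space (torus_complex K)"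
  by (simp add: torus_complex_def Hausdorff_space_subtopology)

lemma continuous_map_euclidean_Complex_iff:
  "continuous_map Z euclidean f \<longleftrightarrow>
     continuous_map Z euclideanreal (\<lambda>z. Re (f z)) \<and> continuous_map Z euclideanreal (\<lambda>z. Im (f z))"
  by (simp add: continuous_map_atin tendsto_complex_iff) blast

lemma continuous_map_torus_complex_iff:
  "continuous_map Z (torus_complex K) \<phi> \<longleftrightarrow>
     (\<forall>z\<in>topspace Z. \<phi> z \<in> topspace (torus_complex K)) \<and>
     (\<forall>v. continuous_map Z euclidean (\<lambda>z. circle_coord v (\<phi> z)))"
proof -
  have "continuous_map Z euclidean \<phi> \<longleftrightarrow> (\<forall>m. continuous_map Z euclideanreal (\<lambda>z. \<phi> z m))"
    unfolding euclidean_product_topology[symmetric] continuous_map_componentwise_UNIV ..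
  also have "\<dots> \<longleftrightarrow> (\<forall>v. continuous_map Z euclideanreal (\<lambda>z. \<phi> z (2 * v)) \<and>
                      continuous_map Z euclideanreal (\<lambda>z. \<phi> z (2 * v + 1)))"
    by (metis evenE oddE)
  also have "\<dots> \<longleftrightarrow> (\<forall>v. continuous_map Z euclidean (\<lambda>z. circle_coord v (\<phi> z)))"
    by (simp add: continuous_map_euclidean_Complex_iff circle_coord_def)
  finally show ?thesis
    by (auto simp: torus_complex_def continuous_map_in_subtopology)
qed

lemma continuous_map_circle_coord:
  "continuous_map (torus_complex K) euclidean (circle_coord v)"
  using continuous_map_torus_complex_iff[of "torus_complex K" K "\<lambda>x. x"] by simp

text \<open>\<open>K\<close> is a finite simplicial complex. Closure under subsets keeps cell
  boundaries and contractions inside the space, since both only shrink supports.\<close>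

locale torus_faces =
  fixes K :: "nat set set"
  assumes finite_faces: "finite K"
    and finite_face: "J \<in> K \<Longrightarrow> finite J"
    and face_subset: "\<lbrakk>J \<in> K; J' \<subseteq> J\<rbrakk> \<Longrightarrow> J' \<in> K"
begin

section \<open>Characteristic maps of the cells\<close>

definition cell_index :: "nat set \<Rightarrow> nat \<Rightarrow> nat" where
  "cell_index J = (SOME h. bij_betw h J {..<card J})"

text \<open>The disc is mapped to the cube with sides \<open>{-1..1}\<close>, and each side is
  wrapped once around its circle with both endpoints going to the base point 1.\<close>

definition cell_map :: "nat set \<Rightarrow> (nat \<Rightarrow> real) \<Rightarrow> nat \<Rightarrow> real" where
  "cell_map J y = from_coords (\<lambda>v. if v \<in> J
     then cis (pi * (1 + disc_to_cube (card J) y (cell_index J v))) else 1)"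

lemma cell_index: "J \<in> K \<Longrightarrow> bij_betw (cell_index J) J {..<card J}"
  unfolding cell_index_def
  using someI_ex[OF ex_bij_betw_finite_nat[OF finite_face[of J]]] by (simp add: atLeast0LessThan)

lemma cis_pi_eq_1_iff: "\<bar>t\<bar> \<le> 1 \<Longrightarrow> cis (pi * (1 + t)) = 1 \<longleftrightarrow> \<bar>t\<bar> = 1"
proof
  assume t: "\<bar>t\<bar> \<le> 1" and "cis (pi * (1 + t)) = 1"
  then have "cos (pi * (1 + t)) = 1" by (simp add: complex_eq_iff)
  then have "cos (pi * t) = cos pi" by (simp add: distrib_left)
  \<comment> \<open>Evenness of cosine moves the angle into the interval from 0 to
    \<open>pi\<close>, where cosine is injective.\<close>
  then have "cos (pi * \<bar>t\<bar>) = cos pi" by (cases "0 \<le> t") simp_all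
  moreover have "pi * \<bar>t\<bar> \<le> pi" using t pi_gt_zero by (simp add: mult_le_cancel_left1)
  ultimately have "pi * \<bar>t\<bar> = pi" using cos_inj_pi[of "pi * \<bar>t\<bar>" pi] by simp
  then show "\<bar>t\<bar> = 1" by simp
next
  assume "\<bar>t\<bar> = 1"
  then have "t = 1 \<or> t = -1" by linarith
  then show "cis (pi * (1 + t)) = 1" by (auto simp: mult.commute[of pi] cis_2pi)
qed

text \<open>Up to a common sign the values are \<open>cis (pi * s)\<close> and
  \<open>cis (pi * t)\<close>, whose angles lie in the range of \<open>Arg\<close> and are recovered
  by it.\<close>

lemma cis_pi_inj:
  assumes "\<bar>s\<bar> < 1" "\<bar>t\<bar> < 1" "cis (pi * (1 + s)) = cis (pi * (1 + t))" shows "s = t"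
proof -
  have "- cis (pi * s) = - cis (pi * t)" 
    using assms(3) by (simp add: distrib_left cis_mult[symmetric])
  then have "Arg (cis (pi * s)) = Arg (cis (pi * t))" by simp
  moreover have "Arg (cis (pi * r)) = pi * r" if "\<bar>r\<bar> < 1" for r
  proof (rule cis_Arg_unique)
    show "sgn (cis (pi * r)) = cis (pi * r)" by (simp add: sgn_eq)
    show "- pi < pi * r" "pi * r \<le> pi"
      using that mult_strict_left_mono[of "-1" r pi] mult_left_mono[of r 1 pi] by auto
  qed
  ultimately show ?thesis using assms by simp
qed

lemma disc_to_cube_le:
  assumes "i < n" shows "\<bar>disc_to_cube n y i\<bar> \<le> l2_norm n y"
  using abs_le_sup_norm[OF assms, of "disc_to_cube n y"] by (simp add: sup_norm_disc_to_cube)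

lemma cell_index_less: "\<lbrakk>J \<in> K; v \<in> J\<rbrakk> \<Longrightarrow> cell_index J v < card J"
  using cell_index by (auto simp: bij_betw_def)

lemma torus_supp_cell_map:
  assumes "J \<in> K" "y \<in> closed_disc (card J)"
  shows "torus_supp (cell_map J y) = {v \<in> J. \<bar>disc_to_cube (card J) y (cell_index J v)\<bar> < 1}"
proof -
  have "l2_norm (card J) y \<le> 1" using assms(2) by (simp add: closed_disc_def l2_norm_def)
  then have "\<bar>disc_to_cube (card J) y (cell_index J v)\<bar> \<le> 1" if "v \<in> J" for v
    using disc_to_cube_le[OF cell_index_less[OF assms(1) that], of y] by linarith
  then show ?thesis
    using cis_pi_eq_1_iff by (force simp: torus_supp_def cell_map_def)
qed

lemma cell_map_in_torus_complex:
  assumes "J \<in> K" "y \<in> closed_disc (card J)"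
  shows "cell_map J y \<in> topspace (torus_complex K)"
  using assms face_subset[OF assms(1)] unfolding topspace_torus_complex
  by (auto simp: torus_supp_cell_map) (simp add: cell_map_def)

lemma continuous_map_cell_map:
  assumes "J \<in> K"
  shows "continuous_map (subtopology (Euclidean_space (card J)) (closed_disc (card J))) (torus_complex K) (cell_map J)"
  unfolding continuous_map_torus_complex_iff
proof (intro conjI ballI allI)
  fix v
  show "continuous_map (subtopology (Euclidean_space (card J)) (closed_disc (card J))) euclidean
      (\<lambda>y. circle_coord v (cell_map J y))"
  proof (cases "v \<in> J")
    case True
    have "continuous_on UNIV (\<lambda>y. cis (pi * (1 + disc_to_cube (card J) y (cell_index J v))))"
      by (intro continuous_on_cis continuous_on_mult continuous_on_add continuous_on_const
          continuous_disc_to_cube cell_index_less assms True)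
    then have "continuous_map (Euclidean_space (card J)) euclidean
        (\<lambda>y. cis (pi * (1 + disc_to_cube (card J) y (cell_index J v))))"
      unfolding continuous_map_Euclidean_space_iff by (rule continuous_on_subset) simp
    then show ?thesis using True by (simp add: cell_map_def continuous_map_from_subtopology)
  qed (simp add: cell_map_def)
qed (use cell_map_in_torus_complex[OF assms] in auto)

text \<open>Open cells are the strata of constant support, which makes them a partition of the
  space.\<close>

lemma cell_map_image:
  assumes J: "J \<in> K"
  shows "cell_map J ` open_disc (card J) = {x \<in> topspace (torus_complex K). torus_supp x = J}"
proof (intro equalityI subsetI)
  fix x assume "x \<in> cell_map J ` open_disc (card J)"
  then obtain y where y: "y \<in> open_disc (card J)" "x = cell_map J y" by blast
  then have yc: "y \<in> closed_disc (card J)" and "l2_norm (card J) y < 1"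
    by (auto simp: open_disc_def closed_disc_def l2_norm_def)
  then have "\<bar>disc_to_cube (card J) y (cell_index J v)\<bar> < 1" if "v \<in> J" for v
    using disc_to_cube_le[OF cell_index_less[OF J that], of y] by linarith
  then show "x \<in> {x \<in> topspace (torus_complex K). torus_supp x = J}"
    using cell_map_in_torus_complex[OF J yc] torus_supp_cell_map[OF J yc] y by auto
next
  fix x assume x: "x \<in> {x \<in> topspace (torus_complex K). torus_supp x = J}"
  have ang: "\<exists>t. \<bar>t\<bar> < 1 \<and> cis (pi * (1 + t)) = circle_coord v x" if "v \<in> J" for v
  proof -
    have n1: "norm (circle_coord v x) = 1" and ne: "circle_coord v x \<noteq> 1"
      using x that by (auto simp: topspace_torus_complex torus_supp_def)
    \<comment> \<open>The sign comes from \<open>cis (pi * (1 + t)) = - cis (pi * t)\<close>. The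
      value \<open>\<bar>t\<bar> = 1\<close> would give the base point, which is excluded on the
      support.\<close>
    define t where "t = Arg (- circle_coord v x) / pi"
    have "- circle_coord v x \<noteq> 0" using n1 by auto
    then have "cis (Arg (- circle_coord v x)) = - circle_coord v x"
      using n1 by (simp add: cis_Arg sgn_eq)
    then have eq: "cis (pi * (1 + t)) = circle_coord v x"
      by (simp add: t_def distrib_left cis_mult[symmetric])
    have "\<bar>t\<bar> \<le> 1" using Arg_bounded[of "- circle_coord v x"] by (auto simp: t_def abs_le_iff field_simps)
    then have "\<bar>t\<bar> < 1" using eq ne cis_pi_eq_1_iff[of t] by (cases "\<bar>t\<bar> = 1") auto
    then show ?thesis using eq by blast
  qed
  then obtain t where t: "\<And>v. v \<in> J \<Longrightarrow> \<bar>t v\<bar> < 1 \<and> cis (pi * (1 + t v)) = circle_coord v x"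
    by metis
  define a where "a i = t (inv_into J (cell_index J) i)" for i
  have a: "a (cell_index J v) = t v" if "v \<in> J" for v
    using cell_index[OF J] that by (simp add: a_def bij_betw_inv_into_left)
  have "\<bar>a i\<bar> < 1" if "i < card J" for i
    using cell_index[OF J] that t bij_betw_imp_surj_on
    by (metis a_def inv_into_into lessThan_iff)
  then have "sup_norm (card J) a < 1" by (simp add: sup_norm_less_iff)
  then obtain y where y: "y \<in> open_disc (card J)" "\<And>i. i < card J \<Longrightarrow> disc_to_cube (card J) y i = a i"
    using disc_to_cube_surj by blast
  have "cell_map J y = x"
  proof (rule circle_coord_eqI)
    fix v show "circle_coord v (cell_map J y) = circle_coord v x"
    proof (cases "v \<in> J")
      case True
      then show ?thesis using y(2)[OF cell_index_less[OF J True]] a t by (simp add: cell_map_def)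
    next
      case False
      then show ?thesis using x by (auto simp: cell_map_def torus_supp_def)
    qed
  qed
  then show "x \<in> cell_map J ` open_disc (card J)" using y(1) by blast
qed

lemma inj_on_cell_map:
  assumes J: "J \<in> K" shows "inj_on (cell_map J) (open_disc (card J))"
proof (rule inj_onI)
  fix y z assume y: "y \<in> open_disc (card J)" and z: "z \<in> open_disc (card J)"
    and eq: "cell_map J y = cell_map J z"
  have less: "\<bar>disc_to_cube (card J) w i\<bar> < 1" if "w \<in> open_disc (card J)" "i < card J" for w i
  proof -
    have "l2_norm (card J) w < 1" using that(1) by (simp add: open_disc_def l2_norm_def)
    then show ?thesis using disc_to_cube_le[OF that(2), of w] by linarith
  qed
  have "disc_to_cube (card J) y i = disc_to_cube (card J) z i" if i: "i < card J" for i
  proof -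
    obtain v where v: "v \<in> J" "cell_index J v = i"
      using cell_index[OF J] i by (metis bij_betw_iff_bijections lessThan_iff)
    have "circle_coord v (cell_map J y) = circle_coord v (cell_map J z)" using eq by simp
    then show ?thesis
      using cis_pi_inj[OF less[OF y i] less[OF z i]] v by (simp add: cell_map_def)
  qed
  then have "y i = z i" if "i < card J" for i using disc_to_cube_inj that by blast
  moreover have "y i = z i" if "\<not> i < card J" for i
    using y z that by (simp add: open_disc_def topspace_Euclidean_space)
  ultimately show "y = z" by blast
qed

text \<open>A boundary point of the disc lands on a face of the cube, so some coordinate has
  absolute value 1 and its circle drops out of the support.\<close>

lemma cell_map_boundary:
  assumes J: "J \<in> K" and y: "y \<in> boundary_sphere (card J)"
  shows "torus_supp (cell_map J y) \<subset> J"
proof -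
  have yc: "y \<in> closed_disc (card J)" and "l2_norm (card J) y = 1"
    using y by (auto simp: boundary_sphere_def closed_disc_def l2_norm_def)
  then obtain i where "i < card J" "\<bar>disc_to_cube (card J) y i\<bar> = 1"
    using sup_norm_attained[of "card J" "disc_to_cube (card J) y"] by (auto simp: sup_norm_disc_to_cube)
  moreover obtain v where "v \<in> J" "cell_index J v = i"
    using cell_index[OF J] \<open>i < card J\<close> by (metis bij_betw_iff_bijections lessThan_iff)
  ultimately have "v \<notin> torus_supp (cell_map J y)" by (simp add: torus_supp_cell_map[OF J yc])
  moreover have "torus_supp (cell_map J y) \<subseteq> J" by (auto simp: torus_supp_cell_map[OF J yc])
  ultimately show ?thesis using \<open>v \<in> J\<close> by blast
qed

text \<open>Cells are indexed by natural numbers, as \<open>finite_CW_space\<close> demands, through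
  the binary coding of finite sets.\<close>

lemma finite_CW_structure_torus_complex:
  "finite_CW_structure (torus_complex K) (set_encode ` K) (\<lambda>m. card (set_decode m)) (\<lambda>m. cell_map (set_decode m))"
proof -
  have dec: "set_decode m \<in> K" if "m \<in> set_encode ` K" for m
    using that finite_face by auto
  have cells: "cell_map (set_decode m) ` open_disc (card (set_decode m))
      = {x \<in> topspace (torus_complex K). torus_supp x = set_decode m}" if "m \<in> set_encode ` K" for m
    using cell_map_image[OF dec[OF that]] .
  have bd: "cell_map J ` boundary_sphere (card J) \<subseteq> {x \<in> topspace (torus_complex K). torus_supp x \<subset> J}"
    if "J \<in> K" for J
  proof clarify
    fix y assume y: "y \<in> boundary_sphere (card J)"
    then have "y \<in> closed_disc (card J)" by (simp add: boundary_sphere_def closed_disc_def)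
    then show "cell_map J y \<in> topspace (torus_complex K) \<and> torus_supp (cell_map J y) \<subset> J"
      using cell_map_in_torus_complex[OF that] cell_map_boundary[OF that y] by blast
  qed
  show ?thesis
    unfolding finite_CW_structure_def
  proof (intro conjI ballI)
    show "Hausdorff_space (torus_complex K)" by (rule Hausdorff_space_torus_complex)
    show "finite (set_encode ` K)" using finite_faces by simp
    have "\<exists>m\<in>set_encode ` K. torus_supp x = set_decode m" if "x \<in> topspace (torus_complex K)" for x
    proof -
      have "torus_supp x \<in> K" using that by (simp add: topspace_torus_complex)
      then show ?thesis using finite_face by (intro bexI[of _ "set_encode (torus_supp x)"]) auto
    qed
    then have "(\<Union>m\<in>set_encode ` K. {x \<in> topspace (torus_complex K). torus_supp x = set_decode m})
        = topspace (torus_complex K)"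
      by (intro equalityI subsetI) (simp_all only: UN_iff mem_Collect_eq simp_thms, blast)
    then show "(\<Union>m\<in>set_encode ` K. cell_map (set_decode m) ` open_disc (card (set_decode m)))
        = topspace (torus_complex K)"
      by (simp only: SUP_cong[OF refl cells])
    show "disjoint_family_on (\<lambda>m. cell_map (set_decode m) ` open_disc (card (set_decode m))) (set_encode ` K)"
      unfolding disjoint_family_on_def
    proof (intro ballI impI)
      fix m m' assume mm: "m \<in> set_encode ` K" "m' \<in> set_encode ` K" "m \<noteq> m'"
      then have "set_decode m \<noteq> set_decode m'" by (metis set_decode_inverse)
      then show "cell_map (set_decode m) ` open_disc (card (set_decode m)) \<inter>
          cell_map (set_decode m') ` open_disc (card (set_decode m')) = {}"
        unfolding cells[OF mm(1)] cells[OF mm(2)] by auto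
    qed
  next
    fix m assume m: "m \<in> set_encode ` K"
    let ?J = "set_decode m"
    show "continuous_map (subtopology (Euclidean_space (card ?J)) (closed_disc (card ?J))) (torus_complex K) (cell_map ?J)"
      by (rule continuous_map_cell_map[OF dec[OF m]])
    show "homeomorphic_map (subtopology (Euclidean_space (card ?J)) (open_disc (card ?J)))
        (subtopology (torus_complex K) (cell_map ?J ` open_disc (card ?J))) (cell_map ?J)"
    proof (rule homeomorphic_map_open_disc)
      show "cell_map ?J ` boundary_sphere (card ?J) \<inter> cell_map ?J ` open_disc (card ?J) = {}"
        using bd[OF dec[OF m]] unfolding cells[OF m] by blast
    qed (use Hausdorff_space_torus_complex continuous_map_cell_map inj_on_cell_map dec[OF m] in auto)
    show "cell_map ?J ` boundary_sphere (card ?J) \<subseteq> (\<Union>m'\<in>{m' \<in> set_encode ` K. card (set_decode m') < card ?J}.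
        cell_map (set_decode m') ` open_disc (card (set_decode m')))"
    proof
      fix x assume "x \<in> cell_map ?J ` boundary_sphere (card ?J)"
      then have x: "x \<in> topspace (torus_complex K)" "torus_supp x \<subset> ?J" using bd[OF dec[OF m]] by auto
      \<comment> \<open>A boundary point lies in the open cell of its own support, a proper subset
        of \<open>?J\<close> and hence of smaller dimension.\<close>
      let ?m = "set_encode (torus_supp x)"
      have K: "torus_supp x \<in> K" using x(1) by (simp add: topspace_torus_complex)
      then have "set_decode ?m = torus_supp x" using finite_face by simp
      moreover have "card (torus_supp x) < card ?J"
        using x(2) finite_face[OF dec[OF m]] psubset_card_mono by blast
      moreover have "?m \<in> set_encode ` K" using K by blast
      ultimately show "x \<in> (\<Union>m'\<in>{m' \<in> set_encode ` K. card (set_decode m') < card ?J}.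
          cell_map (set_decode m') ` open_disc (card (set_decode m')))"
        using cells[of ?m] x(1) by (intro UN_I[of ?m]) auto
    qed
  qed
qed

end

section \<open>An upper bound for maps into subcomplexes of a torus\<close>

definition torus_base :: "nat \<Rightarrow> real" where
  "torus_base = from_coords (\<lambda>_. 1)"

section \<open>Thickened cells and their contractions\<close>

context torus_faces begin

text \<open>An open thickening of the cell of \<open>J\<close>. The first two conditions make the
  arguments used in the contraction continuous; the comparison of real parts separates cells of
  equal dimension.\<close>

definition cell_nbhd :: "nat set \<Rightarrow> (nat \<Rightarrow> real) set" where
  "cell_nbhd J = {x \<in> topspace (torus_complex K).
     (\<forall>u\<in>J. Re (circle_coord u x) < 1) \<and> (\<forall>v\<in>\<Union>K - J. -1 < Re (circle_coord v x)) \<and>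
     (\<forall>u\<in>J. \<forall>v\<in>\<Union>K - J. Re (circle_coord u x) < Re (circle_coord v x))}"

text \<open>\<open>Arg2pi\<close> jumps at the positive reals and \<open>Arg\<close> at the negative
  reals. The choice by \<open>v \<in> J\<close> avoids the jump on \<open>cell_nbhd J\<close> and
  keeps coordinates outside \<open>J\<close> that equal 1 fixed.\<close>

definition cell_contraction :: "nat set \<Rightarrow> real \<times> (nat \<Rightarrow> real) \<Rightarrow> nat \<Rightarrow> real" where
  "cell_contraction J = (\<lambda>(t, x). from_coords (\<lambda>v. cis ((1 - t) *
     (if v \<in> J then Arg2pi (circle_coord v x) else Arg (circle_coord v x)))))"

lemma openin_cell_nbhd:
  assumes "J \<in> K" shows "openin (torus_complex K) (cell_nbhd J)"
proof -
  have fin: "finite J" "finite (\<Union>K - J)" using assms finite_faces finite_face by auto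
  have "cell_nbhd J = topspace (torus_complex K) \<inter>
      ((\<Inter>u\<in>J. {x. x (2 * u) < 1}) \<inter> (\<Inter>v\<in>\<Union>K - J. {x. -1 < x (2 * v)}) \<inter>
       (\<Inter>u\<in>J. \<Inter>v\<in>\<Union>K - J. {x. x (2 * u) < x (2 * v)}))"
    unfolding cell_nbhd_def circle_coord_def complex.sel by blast
  moreover have "open ((\<Inter>u\<in>J. {x :: nat \<Rightarrow> real. x (2 * u) < 1}) \<inter> (\<Inter>v\<in>\<Union>K - J. {x. -1 < x (2 * v)}) \<inter>
       (\<Inter>u\<in>J. \<Inter>v\<in>\<Union>K - J. {x. x (2 * u) < x (2 * v)}))"
    using fin by (intro open_Int open_INT ballI open_Collect_less continuous_on_coordinate continuous_on_const)
  ultimately show ?thesis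
    by (simp add: torus_complex_def openin_open) blast
qed

lemma cell_nbhd_coord:
  assumes J: "J \<in> K" and x: "x \<in> cell_nbhd J"
  shows "norm (circle_coord v x) = 1"
    and "v \<in> J \<Longrightarrow> circle_coord v x \<notin> \<real>\<^sub>\<ge>\<^sub>0"
    and "v \<notin> J \<Longrightarrow> circle_coord v x \<notin> \<real>\<^sub>\<le>\<^sub>0"
proof -
  show n1: "norm (circle_coord v x) = 1"
    using x by (simp add: cell_nbhd_def topspace_torus_complex)
  show "circle_coord v x \<notin> \<real>\<^sub>\<ge>\<^sub>0" if "v \<in> J"
  proof
    assume "circle_coord v x \<in> \<real>\<^sub>\<ge>\<^sub>0"
    then have "Re (circle_coord v x) = 1"
      using n1 by (auto simp: complex_nonneg_Reals_iff cmod_eq_Re)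
    moreover have "Re (circle_coord v x) < 1" using x that unfolding cell_nbhd_def by blast
    ultimately show False by simp
  qed
  show "circle_coord v x \<notin> \<real>\<^sub>\<le>\<^sub>0" if "v \<notin> J"
  proof
    assume "circle_coord v x \<in> \<real>\<^sub>\<le>\<^sub>0"
    then have m1: "Re (circle_coord v x) = -1"
      using n1 by (auto simp: complex_nonpos_Reals_iff cmod_eq_Re)
    \<comment> \<open>The definition of \<open>cell_nbhd\<close> restricts only vertices in
      \<open>\<Union>K\<close>, but a coordinate -1 belongs to the support and so to such a
      vertex.\<close>
    then have "v \<in> torus_supp x" by (auto simp: torus_supp_def)
    moreover have "torus_supp x \<in> K" using x by (simp add: cell_nbhd_def topspace_torus_complex)
    ultimately have "v \<in> \<Union>K - J" using that by blast
    then have "-1 < Re (circle_coord v x)" using x unfolding cell_nbhd_def by blast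
    then show False using m1 by simp
  qed
qed

lemma cell_contraction_in_torus_complex:
  assumes J: "J \<in> K" and x: "x \<in> cell_nbhd J"
  shows "cell_contraction J (t, x) \<in> topspace (torus_complex K)"
proof -
  have "torus_supp (cell_contraction J (t, x)) \<subseteq> torus_supp x"
  proof
    fix v assume v: "v \<in> torus_supp (cell_contraction J (t, x))"
    show "v \<in> torus_supp x"
    proof (rule ccontr)
      assume "v \<notin> torus_supp x"
      then have 1: "circle_coord v x = 1" by (simp add: torus_supp_def)
      then have "v \<notin> J" using cell_nbhd_coord(2)[OF J x] by force
      then show False using v 1 by (simp add: torus_supp_def cell_contraction_def)
    qed
  qed
  moreover have "torus_supp x \<in> K" using x by (simp add: cell_nbhd_def topspace_torus_complex)
  ultimately show ?thesis
    using face_subset by (simp add: topspace_torus_complex) (simp add: cell_contraction_def)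
qed

lemma cell_contraction_0:
  assumes J: "J \<in> K" and x: "x \<in> cell_nbhd J"
  shows "cell_contraction J (0, x) = x"
proof (rule circle_coord_eqI)
  fix v
  have n1: "norm (circle_coord v x) = 1" by (rule cell_nbhd_coord(1)[OF J x])
  then have "circle_coord v x \<noteq> 0" by auto
  then have "cis (Arg (circle_coord v x)) = circle_coord v x" using n1 by (simp add: cis_Arg sgn_eq)
  moreover have "cis (Arg2pi (circle_coord v x)) = circle_coord v x"
    using n1 complex_norm_eq_1_exp[of "circle_coord v x"] by (simp add: cis_conv_exp)
  ultimately show "circle_coord v (cell_contraction J (0, x)) = circle_coord v x"
    by (simp add: cell_contraction_def)
qed

lemma cell_contraction_1: "cell_contraction J (1, x) = torus_base"
  by (simp add: cell_contraction_def torus_base_def)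

lemma continuous_map_cell_contraction:
  assumes J: "J \<in> K"
  shows "continuous_map (prod_topology (top_of_set {0..1}) (subtopology (torus_complex K) (cell_nbhd J)))
           (torus_complex K) (cell_contraction J)" (is "continuous_map ?P _ _")
  unfolding continuous_map_torus_complex_iff
proof (intro conjI ballI allI)
  fix z assume "z \<in> topspace ?P"
  then show "cell_contraction J z \<in> topspace (torus_complex K)"
    using cell_contraction_in_torus_complex[OF J] by (cases z) auto
next
  fix v
  define S where "S = (if v \<in> J then - \<real>\<^sub>\<ge>\<^sub>0 else - \<real>\<^sub>\<le>\<^sub>0 :: complex set)"
  define ang where "ang = (if v \<in> J then Arg2pi else Arg)"
  have "continuous_map (subtopology (torus_complex K) (cell_nbhd J)) (top_of_set S) (circle_coord v)"
    using continuous_map_circle_coord[of K v] cell_nbhd_coord[OF J]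
    by (auto simp: continuous_map_in_subtopology continuous_map_from_subtopology S_def)
  moreover have "continuous_map (top_of_set S) euclideanreal ang"
    unfolding S_def ang_def continuous_map_iff_continuous
    by (auto intro!: continuous_at_imp_continuous_on continuous_at_Arg continuous_at_Arg2pi)
  ultimately have "continuous_map (subtopology (torus_complex K) (cell_nbhd J)) euclideanreal (\<lambda>x. ang (circle_coord v x))"
    by (rule continuous_map_compose[unfolded o_def])
  with continuous_map_snd have "continuous_map ?P euclideanreal (\<lambda>z. ang (circle_coord v (snd z)))"
    by (rule continuous_map_compose[unfolded o_def])
  moreover have "continuous_map ?P euclideanreal fst"
    using continuous_map_fst continuous_map_into_fulltopology by blast
  ultimately have "continuous_map ?P euclideanreal (\<lambda>z. (1 - fst z) * ang (circle_coord v (snd z)))"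
    by (intro continuous_map_real_mult continuous_map_diff) auto
  moreover have "continuous_map euclideanreal euclidean cis"
    using continuous_on_cis[OF continuous_on_id] by simp
  ultimately have "continuous_map ?P euclidean (\<lambda>z. cis ((1 - fst z) * ang (circle_coord v (snd z))))"
    by (rule continuous_map_compose[unfolded o_def])
  then show "continuous_map ?P euclidean (\<lambda>z. circle_coord v (cell_contraction J z))"
    by (simp add: cell_contraction_def ang_def case_prod_unfold if_distrib[of "\<lambda>f. f _"] cong: if_cong)
qed

text \<open>Distinct faces of equal size each have a vertex outside the other, and these two
  vertices would satisfy opposite strict inequalities.\<close>

lemma cell_nbhd_disjoint:
  assumes "J \<in> K" "J' \<in> K" "card J = card J'" "x \<in> cell_nbhd J" "x \<in> cell_nbhd J'"
  shows "J = J'"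
proof (rule ccontr)
  assume "J \<noteq> J'"
  then obtain u v where uv: "u \<in> J - J'" "v \<in> J' - J"
    using assms(1-3) finite_face by (metis Diff_eq_empty_iff all_not_in_conv card_subset_eq)
  then have "u \<in> \<Union>K - J'" "v \<in> \<Union>K - J" using assms(1,2) by auto
  then have "Re (circle_coord u x) < Re (circle_coord v x)" "Re (circle_coord v x) < Re (circle_coord u x)"
    using uv assms(4,5) by (auto simp: cell_nbhd_def)
  then show False by simp
qed

definition stratum_nbhd :: "nat \<Rightarrow> (nat \<Rightarrow> real) set" where
  "stratum_nbhd j = (\<Union>J\<in>{J \<in> K. card J = j}. cell_nbhd J)"

lemma openin_stratum_nbhd: "openin (torus_complex K) (stratum_nbhd j)"
  unfolding stratum_nbhd_def by (intro openin_Union) (auto simp: openin_cell_nbhd)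

text \<open>The contractions of the disjoint open pieces can be pasted, and all end at the same
  point, so the result ends at a single constant map.\<close>

lemma stratum_nbhd_null_homotopic:
  "homotopic_with (\<lambda>_. True) (subtopology (torus_complex K) (stratum_nbhd j)) (torus_complex K)
     (\<lambda>x. x) (\<lambda>_. torus_base)"
proof -
  let ?U = "subtopology (torus_complex K) (stratum_nbhd j)"
  let ?P = "prod_topology (top_of_set {0..1::real}) ?U"
  let ?I = "{J \<in> K. card J = j}"
  have sub: "cell_nbhd J \<subseteq> stratum_nbhd j" if "J \<in> ?I" for J
    using that by (auto simp: stratum_nbhd_def)
  have topU: "topspace ?U = stratum_nbhd j"
    using openin_subset[OF openin_stratum_nbhd] by (simp add: Int_absorb1)
  obtain h where h: "continuous_map ?P (torus_complex K) h"
    "\<And>z J. \<lbrakk>J \<in> ?I; z \<in> topspace ?P \<inter> {0..1} \<times> cell_nbhd J\<rbrakk> \<Longrightarrow> h z = cell_contraction J z"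
  proof (rule pasting_lemma_exists[where X = ?P and I = ?I and
        T = "\<lambda>J. {0..1} \<times> cell_nbhd J" and Y = "torus_complex K" and f = cell_contraction])
    show "topspace ?P \<subseteq> (\<Union>J\<in>?I. {0..1} \<times> cell_nbhd J)"
      using topU by (auto simp: stratum_nbhd_def)
    show "openin ?P ({0..1} \<times> cell_nbhd J)" if "J \<in> ?I" for J
    proof -
      have "openin ?U (cell_nbhd J)"
        using openin_cell_nbhd that sub[OF that] by (simp add: openin_subtopology_Int2 openin_subset_topspace_eq) (metis (no_types, lifting) inf.absorb_iff1 openin_subtopology)
      then show ?thesis by (simp add: openin_prod_Times_iff)
    qed
    show "continuous_map (subtopology ?P ({0..1} \<times> cell_nbhd J)) (torus_complex K) (cell_contraction J)"
      if "J \<in> ?I" for J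
    proof -
      have "subtopology ?P ({0..1} \<times> cell_nbhd J) =
          prod_topology (top_of_set {0..1}) (subtopology (torus_complex K) (cell_nbhd J))"
        using sub[OF that]
        by (simp add: subtopology_Times subtopology_subtopology Int_absorb1)
      then show ?thesis using continuous_map_cell_contraction that by simp
    qed
    show "cell_contraction J z = cell_contraction J' z"
      if "J \<in> ?I" "J' \<in> ?I" "z \<in> topspace ?P \<inter> {0..1} \<times> cell_nbhd J \<inter> {0..1} \<times> cell_nbhd J'" for J J' z
    proof -
      have "J = J'" using that by (intro cell_nbhd_disjoint[of J J' "snd z"]) auto
      then show ?thesis by simp
    qed
  qed blast
  have "h (0, x) = x \<and> h (1, x) = torus_base" if x: "x \<in> stratum_nbhd j" for x
  proof -
    obtain J where J: "J \<in> ?I" "x \<in> cell_nbhd J" using x by (auto simp: stratum_nbhd_def)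
    then have "h (t, x) = cell_contraction J (t, x)" if "t \<in> {0..1}" for t
    proof -
      have "(t, x) \<in> topspace ?P \<inter> {0..1} \<times> cell_nbhd J" using that x topU J(2) by auto
      then show ?thesis by (rule h(2)[OF J(1)])
    qed
    then show ?thesis using J cell_contraction_0 cell_contraction_1 by simp
  qed
  then show ?thesis
    using h(1) topU by (subst homotopic_with) auto
qed

lemma stratum_nbhds_cover:
  assumes x: "x \<in> topspace (torus_complex K)" and n: "card (torus_supp x) \<le> n"
  shows "\<exists>j\<le>n. x \<in> stratum_nbhd j"
proof -
  \<comment> \<open>Cutting at real part 0 separates the coordinates in \<open>J\<close> from all
    others, and \<open>J\<close> lies in the support because the base point has real part 1.\<close>
  define J where "J = {v. Re (circle_coord v x) < 0}"
  have sub: "J \<subseteq> torus_supp x" by (auto simp: J_def torus_supp_def)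
  have K: "torus_supp x \<in> K" using x by (simp add: topspace_torus_complex)
  have "J \<in> K" using face_subset[OF K sub] .
  moreover have "card J \<le> n" using card_mono[OF finite_face[OF K] sub] n by simp
  moreover have "x \<in> cell_nbhd J"
    using x by (force simp: cell_nbhd_def J_def)
  ultimately show ?thesis by (auto simp: stratum_nbhd_def)
qed

text \<open>The preimages of the strata \<open>0..n\<close> cover \<open>Z\<close>; the empty face
  puts the base point into the complex.\<close>

lemma LS_cat_map_torus_complex_le:
  assumes cont: "continuous_map Z (torus_complex K) \<phi>"
    and dim: "\<And>z. z \<in> topspace Z \<Longrightarrow> card (torus_supp (\<phi> z)) \<le> n"
    and K: "{} \<in> K"
  shows "LS_cat_map Z (torus_complex K) \<phi> \<le> enat (n + 1)"
proof -
  define A where "A j = {z \<in> topspace Z. \<phi> z \<in> stratum_nbhd j}" for j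
  have "torus_base \<in> topspace (torus_complex K)"
    using K by (simp add: topspace_torus_complex torus_supp_def torus_base_def)
  moreover have "homotopic_with (\<lambda>_. True) (subtopology Z (A j)) (torus_complex K) \<phi> (\<lambda>_. torus_base)" for j
  proof -
    have "continuous_map (subtopology Z (A j)) (subtopology (torus_complex K) (stratum_nbhd j)) \<phi>"
      using cont by (auto simp: continuous_map_in_subtopology continuous_map_from_subtopology A_def)
    from homotopic_with_compose_continuous_map_right[OF stratum_nbhd_null_homotopic this, of "\<lambda>_. True"]
    show ?thesis by (simp add: o_def)
  qed
  ultimately have "map_categorical Z (torus_complex K) \<phi> (A j)" for j
    unfolding map_categorical_def A_def
    using openin_continuous_map_preimage[OF cont openin_stratum_nbhd] by blast
  moreover have "\<Union>(A ` {..n}) = topspace Z"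
  proof (intro equalityI subsetI)
    fix z assume z: "z \<in> topspace Z"
    then have "\<phi> z \<in> topspace (torus_complex K)"
      using continuous_map_image_subset_topspace[OF cont] by blast
    then obtain j where "j \<le> n" "\<phi> z \<in> stratum_nbhd j" using stratum_nbhds_cover dim z by blast
    then show "z \<in> \<Union>(A ` {..n})" using z by (auto simp: A_def)
  qed (auto simp: A_def)
  ultimately have "map_categorical_covering Z (torus_complex K) \<phi> (A ` {..n})"
    by (auto simp: map_categorical_covering_def)
  then have "LS_cat_map Z (torus_complex K) \<phi> \<le> enat (card (A ` {..n}))"
    unfolding LS_cat_map_def by (intro Inf_lower) blast
  also have "\<dots> \<le> enat (n + 1)" using card_image_le[of "{..n}" A] by simp
  finally show ?thesis .
qed

end

section \<open>Shifting a wedge of tori\<close>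

lemma LS_cat_map_torus_ge:
  fixes E :: "(nat \<Rightarrow> real) \<Rightarrow> 'a" and e :: "nat \<Rightarrow> 'b \<Rightarrow> complex"
  assumes X: "compact_space X" "Hausdorff_space X"
    and conte: "\<And>i. i < n \<Longrightarrow> continuous_map Y euclidean (e i)"
    and norme: "\<And>i y. \<lbrakk>i < n; y \<in> topspace Y\<rbrakk> \<Longrightarrow> norm (e i y) = 1"
    and contE: "continuous_map euclidean X E"
    and sec: "\<And>i \<theta>. i < n \<Longrightarrow> e i (\<phi> (E \<theta>)) = cis (\<theta> i)"
  shows "enat (n + 1) \<le> LS_cat_map X Y \<phi>"
  unfolding LS_cat_map_def
proof (rule Inf_greatest, clarify)
  fix \<A> assume fin: "finite \<A>" and cov: "map_categorical_covering X Y \<phi> \<A>"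
  have "n < card \<A>"
  proof (rule ccontr)
    assume "\<not> n < card \<A>"
    then have le: "card \<A> \<le> n" by simp
    obtain A where "bij_betw A {0..<card \<A>} \<A>" using ex_bij_betw_nat_finite[OF fin] by blast
    then have A: "A ` {..<card \<A>} = \<A>" by (simp add: bij_betw_def atLeast0LessThan)
    \<comment> \<open>With at most \<open>n\<close> sets, one circle coordinate per set suffices, so
      only the first \<open>card \<A>\<close> coordinates are used.\<close>
    show False
    proof (rule no_categorical_cover_torus[OF X, where n = "card \<A>" and A = A and \<phi> = \<phi> and e = e and E = E])
      show "map_categorical X Y \<phi> (A i)" if "i < card \<A>" for i
        using cov A that by (auto simp: map_categorical_covering_def)
      show "topspace X = (\<Union>i<card \<A>. A i)"
        using cov A by (simp add: map_categorical_covering_def)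
    qed (use le conte norme contE sec in auto)
  qed
  then show "enat (n + 1) \<le> enat (card \<A>)" by simp
qed

text \<open>\<open>w j\<close> is the dimension of the torus with index \<open>j\<close>, and
  \<open>M\<close> is the last index. Positivity of \<open>M\<close> gives the last torus a
  predecessor, as \<open>shift\<close> requires.\<close>

locale torus_wedge =
  fixes w :: "nat \<Rightarrow> nat" and M :: nat
  assumes M_pos: "1 \<le> M" and w_Suc: "w (Suc j) \<le> w j"
begin

text \<open>The vertex \<open>prod_encode (j, i)\<close> is circle \<open>i\<close> of torus
  \<open>j\<close>. A face stays within one torus, so different tori meet only in the base
  point.\<close>

definition wedge_faces :: "nat set set" where
  "wedge_faces = {J. \<exists>j\<le>M. J \<subseteq> (\<lambda>i. prod_encode (j, i)) ` {..<w j}}"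

text \<open>Entries of \<open>z\<close> from \<open>w j\<close> on are ignored, so passing from
  \<open>j\<close> to \<open>Suc j\<close> with the same \<open>z\<close> is exactly the projection
  of one torus onto the next.\<close>

definition block_point :: "nat \<Rightarrow> (nat \<Rightarrow> complex) \<Rightarrow> nat \<Rightarrow> real" where
  "block_point j z = from_coords (\<lambda>v. case prod_decode v of (j', i) \<Rightarrow> if j' = j \<and> i < w j then z i else 1)"

text \<open>The last torus receives both its predecessor and itself. Multiplication on the circle
  combines the two maps: on a point of the wedge at least one factor is 1.\<close>

definition shift :: "(nat \<Rightarrow> real) \<Rightarrow> nat \<Rightarrow> real" where
  "shift x = from_coords (\<lambda>v. case prod_decode v of (j, i) \<Rightarrow>
     if j = 0 \<or> M < j \<or> w j \<le> i then 1
     else circle_coord (prod_encode (j - 1, i)) x *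
       (if j = M then circle_coord (prod_encode (M, i)) x else 1))"

sublocale torus_faces wedge_faces
proof
  have "wedge_faces = (\<Union>j\<in>{..M}. Pow ((\<lambda>i. prod_encode (j, i)) ` {..<w j}))"
    by (auto simp: wedge_faces_def)
  then show "finite wedge_faces" by simp
  show "finite J" if "J \<in> wedge_faces" for J
    using that by (auto simp: wedge_faces_def intro: finite_subset)
  show "J' \<in> wedge_faces" if "J \<in> wedge_faces" "J' \<subseteq> J" for J J'
    using that unfolding wedge_faces_def by blast
qed

lemma w_antimono: "i \<le> j \<Longrightarrow> w j \<le> w i"
  by (rule lift_Suc_antimono_le[of w]) (rule w_Suc)

lemma torus_supp_block_point: "torus_supp (block_point j z) \<subseteq> (\<lambda>i. prod_encode (j, i)) ` {..<w j}"
proof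
  fix v assume v: "v \<in> torus_supp (block_point j z)"
  obtain j' i where "v = prod_encode (j', i)" by (metis prod_decode_inverse surj_pair)
  then show "v \<in> (\<lambda>i. prod_encode (j, i)) ` {..<w j}"
    using v by (auto simp: torus_supp_def block_point_def split: if_splits)
qed

lemma card_torus_supp_block_point: "card (torus_supp (block_point j z)) \<le> w j"
proof -
  have "card (torus_supp (block_point j z)) \<le> card ((\<lambda>i. prod_encode (j, i)) ` {..<w j})"
    using torus_supp_block_point by (intro card_mono) auto
  also have "\<dots> \<le> w j" using card_image_le[of "{..<w j}"] by simp
  finally show ?thesis .
qed

lemma block_point_in_torus_complex:
  assumes "j \<le> M" "\<And>i. norm (z i) = 1"
  shows "block_point j z \<in> topspace (torus_complex wedge_faces)"
proof -
  have "torus_supp (block_point j z) \<in> wedge_faces"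
    using torus_supp_block_point assms(1) unfolding wedge_faces_def by blast
  then show ?thesis
    using assms(2) by (simp add: topspace_torus_complex) (simp add: block_point_def split: prod.split)
qed

lemma block_pointE:
  assumes x: "x \<in> topspace (torus_complex wedge_faces)"
  obtains j z where "j \<le> M" "\<And>i. norm (z i) = 1" "x = block_point j z"
proof -
  obtain j where j: "j \<le> M" "torus_supp x \<subseteq> (\<lambda>i. prod_encode (j, i)) ` {..<w j}"
    using x by (auto simp: topspace_torus_complex wedge_faces_def)
  have "x = block_point j (\<lambda>i. circle_coord (prod_encode (j, i)) x)"
  proof (rule circle_coord_eqI)
    fix v
    obtain j' i where v: "v = prod_encode (j', i)" by (metis prod_decode_inverse surj_pair)
    have "circle_coord v x = 1" if "\<not> (j' = j \<and> i < w j)"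
    proof -
      have "v \<notin> (\<lambda>i. prod_encode (j, i)) ` {..<w j}" using v that by auto
      then show ?thesis using j(2) by (auto simp: torus_supp_def)
    qed
    then show "circle_coord v x = circle_coord v (block_point j (\<lambda>i. circle_coord (prod_encode (j, i)) x))"
      by (auto simp: block_point_def v)
  qed
  moreover have "norm (circle_coord (prod_encode (j, i)) x) = 1" for i
    using x by (simp add: topspace_torus_complex)
  ultimately show thesis using that[of j "\<lambda>i. circle_coord (prod_encode (j, i)) x"] j(1) by simp
qed

lemma shift_block_point:
  assumes "j \<le> M" shows "shift (block_point j z) = block_point (min (Suc j) M) z"
proof (rule circle_coord_eqI)
  fix v
  obtain j' i where v: "v = prod_encode (j', i)" by (metis prod_decode_inverse surj_pair)
  \<comment> \<open>Since the dimensions decrease, every circle of the target torus has its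
    counterpart in the source torus.\<close>
  have le: "w M \<le> w (M - 1)" "j' \<noteq> 0 \<Longrightarrow> w j' \<le> w (j' - 1)" by (auto intro: w_antimono)
  show "circle_coord v (shift (block_point j z)) = circle_coord v (block_point (min (Suc j) M) z)"
  proof (cases "j = M")
    case True
    then show ?thesis using M_pos by (auto simp: v shift_def block_point_def)
  next
    case False
    then have "j < M" using assms by simp
    then show ?thesis using le w_Suc[of j] by (auto simp: v shift_def block_point_def min_def)
  qed
qed

lemma funpow_shift_block_point:
  assumes "j \<le> M" shows "(shift ^^ k) (block_point j z) = block_point (min (j + k) M) z"
proof (induction k)
  case (Suc k)
  then show ?case by (simp add: shift_block_point) (simp add: min_def)
qed (use assms in simp)

lemma continuous_map_shift:
  "continuous_map (torus_complex wedge_faces) (torus_complex wedge_faces) shift"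
  unfolding continuous_map_torus_complex_iff
proof (intro conjI ballI allI)
  fix x assume "x \<in> topspace (torus_complex wedge_faces)"
  then show "shift x \<in> topspace (torus_complex wedge_faces)"
    by (metis block_pointE shift_block_point block_point_in_torus_complex min.cobounded2)
next
  fix v
  have "continuous_map (torus_complex wedge_faces) euclidean (\<lambda>x. circle_coord u x * circle_coord u' x)" for u u'
    using continuous_map_circle_coord[of wedge_faces u] continuous_map_circle_coord[of wedge_faces u']
    by (simp add: continuous_map_atin tendsto_mult)
  moreover obtain j i where "v = prod_encode (j, i)" by (metis prod_decode_inverse surj_pair)
  ultimately show "continuous_map (torus_complex wedge_faces) euclidean (\<lambda>x. circle_coord v (shift x))"
    using continuous_map_circle_coord[of wedge_faces] by (cases "j = M") (simp_all add: shift_def)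
qed

text \<open>The exponent \<open>k = 0\<close> is included and gives the category of the space
  itself. The image of the iterate has dimension at most \<open>w (min k M)\<close>, and torus 0 is
  mapped onto a torus of that dimension.\<close>

lemma LS_cat_map_shift:
  "LS_cat_map (torus_complex wedge_faces) (torus_complex wedge_faces) (shift ^^ k) = enat (w (min k M) + 1)"
proof (rule antisym)
  let ?X = "torus_complex wedge_faces"
  have cont: "continuous_map ?X ?X (shift ^^ k)"
    by (induction k) (auto intro: continuous_map_compose continuous_map_shift simp del: o_apply)
  have "card (torus_supp ((shift ^^ k) x)) \<le> w (min k M)" if "x \<in> topspace ?X" for x
  proof -
    obtain j z where "j \<le> M" "x = block_point j z" using \<open>x \<in> topspace ?X\<close> block_pointE by metis
    then have "(shift ^^ k) x = block_point (min (j + k) M) z" by (simp add: funpow_shift_block_point)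
    then have "card (torus_supp ((shift ^^ k) x)) \<le> w (min (j + k) M)"
      by (simp add: card_torus_supp_block_point)
    also have "\<dots> \<le> w (min k M)" by (rule w_antimono) auto
    finally show ?thesis .
  qed
  then show "LS_cat_map ?X ?X (shift ^^ k) \<le> enat (w (min k M) + 1)"
    by (rule LS_cat_map_torus_complex_le[OF cont]) (auto simp: wedge_faces_def)
  \<comment> \<open>\<open>E\<close> wraps the angles around torus 0, and \<open>e\<close> reads off
    the coordinates of the torus where the iterate arrives.\<close>
  show "enat (w (min k M) + 1) \<le> LS_cat_map ?X ?X (shift ^^ k)"
  proof (rule LS_cat_map_torus_ge[where e = "\<lambda>i. circle_coord (prod_encode (min k M, i))"
        and E = "\<lambda>\<theta>. block_point 0 (\<lambda>i. cis (\<theta> i))"])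
    show "compact_space ?X"
      using finite_CW_structure_torus_complex by (rule finite_CW_structure_imp_compact_space)
    show "Hausdorff_space ?X" by (rule Hausdorff_space_torus_complex)
    show "continuous_map euclidean ?X (\<lambda>\<theta>. block_point 0 (\<lambda>i. cis (\<theta> i)))"
      unfolding continuous_map_torus_complex_iff
    proof (intro conjI ballI allI)
      fix v
      obtain j i where v: "v = prod_encode (j, i)" by (metis prod_decode_inverse surj_pair)
      have "continuous_on UNIV (\<lambda>\<theta> :: nat \<Rightarrow> real. cis (\<theta> i))" for i
        by (intro continuous_on_cis continuous_on_coordinate)
      then show "continuous_map euclidean euclidean (\<lambda>\<theta>. circle_coord v (block_point 0 (\<lambda>i. cis (\<theta> i))))"
        by (cases "j = 0 \<and> i < w 0") (auto simp: v block_point_def)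
    qed (simp add: block_point_in_torus_complex)
    show "circle_coord (prod_encode (min k M, i)) ((shift ^^ k) (block_point 0 (\<lambda>i. cis (\<theta> i)))) = cis (\<theta> i)"
      if "i < w (min k M)" for i \<theta>
      using that by (simp add: funpow_shift_block_point) (simp add: block_point_def)
  qed (auto simp: continuous_map_circle_coord topspace_torus_complex)
qed

end

section \<open>Realizing a given sequence\<close>

theorem mainTheorem1:
  fixes a :: "nat \<Rightarrow> nat"
  assumes "\<And>k. k \<ge> 1 \<Longrightarrow> a k > 0"
    and "\<And>k. k \<ge> 1 \<Longrightarrow> a k \<ge> a (k + 1)"
  shows "\<exists>(X :: (nat \<Rightarrow> real) topology) f.
           finite_CW_space X \<and> continuous_map X X f \<and>
           (\<forall>k\<ge>1. LS_cat_map X X (f ^^ k) = enat (a k)) \<and>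
           LS_cat X = enat (a 1) \<and> LS_cat_map X X f = enat (a 1)"
proof -
  \<comment> \<open>A torus of dimension n accounts for category n + 1. With \<open>max j 1\<close>
    torus 0 repeats the dimension of torus 1, so the identity and the map itself both get category
    \<open>a 1\<close>.\<close>
  define w where "w j = a (max j 1) - 1" for j
  have w_Suc: "w (Suc j) \<le> w j" for j
    using assms(2)[of j] by (cases j) (auto simp: w_def intro: diff_le_mono)
  \<comment> \<open>The sequence attains its minimum at \<open>M\<close>; being non-increasing, it
    is constant from there on.\<close>
  obtain M where M: "1 \<le> M" "\<And>k. 1 \<le> k \<Longrightarrow> a M \<le> a k"
    using ex_has_least_nat[of "\<lambda>k. 1 \<le> k" 1 a] by auto
  interpret torus_wedge w M by unfold_locales (use M(1) w_Suc in auto)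
  let ?X = "torus_complex wedge_faces"
  have cat: "LS_cat_map ?X ?X (shift ^^ k) = enat (a (max k 1))" for k
  proof -
    have pos: "a (max k 1) > 0" using assms(1) by simp
    have "w (min k M) = w k"
    proof (cases "k \<le> M")
      case False
      then have "w k \<le> w M" "a M \<le> a k" using M w_antimono by auto
      then show ?thesis using False M(1) by (simp add: w_def max_def diff_le_mono)
    qed (simp add: min_def)
    then show ?thesis using pos by (simp add: LS_cat_map_shift w_def)
  qed
  have "finite_CW_space ?X"
    unfolding finite_CW_space_def using finite_CW_structure_torus_complex by blast
  moreover have "\<forall>k\<ge>1. LS_cat_map ?X ?X (shift ^^ k) = enat (a k)" using cat by (simp add: max_def)
  \<comment> \<open>The zeroth iterate is the identity.\<close>
  moreover have "LS_cat ?X = enat (a 1)" using cat[of 0] by (simp add: LS_cat_def id_def)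
  moreover have "LS_cat_map ?X ?X shift = enat (a 1)" using cat[of 1] by simp
  ultimately show ?thesis using continuous_map_shift by blast
qed

end
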